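(* Let $p$ be prime, and let $G$ be an abelian group of order $p^n$ and exponent $p^e$. Then there exists a $(G,\lfloor n/e\rfloor,0)$ contracted difference matrix.
   Context: All groups are finite and non-trivial (so $n,e\ge 1$ here), and abelian groups are written additively. Difference matrix: for a non-trivial group $G$, a $(G,m,\lambda)$ difference matrix is an $m\times\lambda|G|$ matrix $(a_{ij})$ with entries in $G$ such that, for all distinct rows $i$ and $\ell$, the multiset of differences $\{a_{ij}-a_{\ell j} : 0\le j\le \lambda|G|-1\}$ contains each element of $G$ exactly $\lambda$ times. $p$-expansion: let $p$ be prime and let $M$ be a $k\times\ell$ matrix over an abelian $p$-group $G$. The $p$-expansion $f_p(M)$ is the $p^k\times p^\ell$ matrix over $G$ whose rows are indexed by $\mathbf{r}\in\mathbb{Z}_p^k$ and whose columns are indexed by $\mathbf{c}\in\mathbb{Z}_p^\ell$, with $(\mathbf{r},\mathbf{c})$ entry $\mathbf{r}M\mathbf{c}^{\intercal}=\sum_{i,j} r_i c_j M_{ij}$, where $\mathbf r,\mathbf c$ are row vectors whose entries are taken as the integer representatives in $\{0,1,\dots,p-1\}$, and integers act on $G$ in the usual way. Contracted difference matrix: let $p$ be prime and let $G$ be an abelian group of order $p^n$. A $k\times(n+s)$ matrix $M$ over $G$ is a $(G,k,s)$ contracted difference matrix if the $p^k\times p^{n+s}$ matrix $f_p(M)$ is a $(G,p^k,p^s)$ difference matrix. *)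

theory Defs
  imports "HOL-Algebra.Algebra" "HOL-Library.FuncSet"
begin

text \<open>Groups are those of HOL-Algebra, so the abelian groups of the (additively written)
  source appear here in multiplicative notation: a difference $a - b$ is
  \<open>a \<otimes> inv b\<close> and an integer multiple is a power.\<close>

definition has_exponent :: "('a, 'b) monoid_scheme \<Rightarrow> nat \<Rightarrow> bool" where
  "has_exponent G m \<longleftrightarrow>
     0 < m \<and> (\<forall>x\<in>carrier G. x [^]\<^bsub>G\<^esub> m = \<one>\<^bsub>G\<^esub>) \<and>
     (\<forall>k. 0 < k \<and> (\<forall>x\<in>carrier G. x [^]\<^bsub>G\<^esub> k = \<one>\<^bsub>G\<^esub>) \<longrightarrow> m \<le> k)"

text \<open>The rows and columns of a matrix may be indexed by arbitrary finite sets \<open>R\<close> and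
  \<open>C\<close>; only their cardinalities are prescribed.  As \<^const>\<open>order\<close> is \<open>0\<close> for an infinite
  carrier, \<open>1 < order G\<close> says that \<open>G\<close> is finite and non-trivial.\<close>

definition difference_matrix ::
  "('a, 'b) monoid_scheme \<Rightarrow> nat \<Rightarrow> nat \<Rightarrow> 'r set \<Rightarrow> 'c set \<Rightarrow> ('r \<Rightarrow> 'c \<Rightarrow> 'a) \<Rightarrow> bool" where
  "difference_matrix G m lam R C A \<longleftrightarrow>
     group G \<and> 1 < order G \<and>
     finite R \<and> card R = m \<and> finite C \<and> card C = lam * order G \<and>
     (\<forall>i\<in>R. \<forall>j\<in>C. A i j \<in> carrier G) \<and>
     (\<forall>i\<in>R. \<forall>l\<in>R. i \<noteq> l \<longrightarrow>
        (\<forall>g\<in>carrier G. card {j \<in> C. A i j \<otimes>\<^bsub>G\<^esub> inv\<^bsub>G\<^esub> A l j = g} = lam))"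

text \<open>The tuples in $\mathbb{Z}_p^k$, given by their representatives in $\{0,\dots,p-1\}$.\<close>

definition residue_tuples :: "nat \<Rightarrow> nat \<Rightarrow> (nat \<Rightarrow> nat) set" where
  "residue_tuples p k = {..<k} \<rightarrow>\<^sub>E {..<p}"

text \<open>The \<open>(r, c)\<close> entry of the \<open>p\<close>-expansion of a \<open>k \<times> l\<close> matrix \<open>M\<close>; the dependence on
  \<open>p\<close> is only through the index sets \<open>residue_tuples p k\<close> and \<open>residue_tuples p l\<close>.\<close>

definition expansion ::
  "('a, 'b) monoid_scheme \<Rightarrow> nat \<Rightarrow> nat \<Rightarrow> (nat \<Rightarrow> nat \<Rightarrow> 'a) \<Rightarrow> (nat \<Rightarrow> nat) \<Rightarrow> (nat \<Rightarrow> nat) \<Rightarrow> 'a" where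
  "expansion G k l M r c =
     finprod G (\<lambda>(i, j). M i j [^]\<^bsub>G\<^esub> (r i * c j)) ({..<k} \<times> {..<l})"

definition contracted_difference_matrix ::
  "('a, 'b) monoid_scheme \<Rightarrow> nat \<Rightarrow> nat \<Rightarrow> nat \<Rightarrow> nat \<Rightarrow> (nat \<Rightarrow> nat \<Rightarrow> 'a) \<Rightarrow> bool" where
  "contracted_difference_matrix G p n k s M \<longleftrightarrow>
     Factorial_Ring.prime p \<and> comm_group G \<and> order G = p ^ n \<and>
     (\<forall>i<k. \<forall>j<n + s. M i j \<in> carrier G) \<and>
     difference_matrix G (p ^ k) (p ^ s) (residue_tuples p k) (residue_tuples p (n + s))
       (expansion G k (n + s) M)"

end

theory Submission
  imports Defs "HOL-Number_Theory.Residues"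
begin

text \<open>
  Everything reduces to a property of the columns of a $k \times n$ matrix $M$ over $G$, $k
  = \lfloor n/e \rfloor$ (in the multiplicative notation of the formalization): for integers
  $d_i$ not all divisible by $p$ and integers $c_j$ with $|c_j| < p$, $\prod_{i,j}
  M_{ij}^{d_i c_j} = 1$ only if $c = 0$. With $d$ a difference of two rows and $c$ a
  difference of two columns of the expansion, this says that the quotient of two distinct
  rows is an injective, hence bijective, function from the $p^n$ columns to $G$
  (\<open>contracted_difference_matrixI\<close>).

  The property can be assembled along a filtration of $G$ with elementary abelian layers,
  because a relation read modulo a subgroup $H$ only involves the columns belonging to the
  layers above $H$ (\<open>exists_independent_matrix\<close>). So two things are needed.

  First, a layer of order $p^r$ with $r \ge k$ must have a matrix. Identify it with the
  additive group of the field with $p^r$ elements and take as entries the products $b_i b_j$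
  of elements of a basis, keeping $k$ rows: the combination with coefficients $d_i c_j$ is
  the product of $\sum_i d_i b_i$ and $\sum_j c_j b_j$, and the field has no zero divisors
  (\<open>structure_constants_nonsingular\<close>, \<open>elementary_layer_matrix\<close>).
  The field is the set of fixed points of the $p^r$-th power map in an algebraic closure of
  the field with $p$ elements.

  Second, $G$ must have a filtration with $e$ layers, all of rank at least $k$. It is built
  from the top: if $|B| = p^n$, $B$ has exponent dividing $p^{e+1}$ and $k(e+1) \le n$,
  there is a subgroup $H$ of exponent dividing $p^e$ and order at least $p^{ke}$ such that
  $B/H$ is elementary abelian of rank at least $k$ (\<open>exists_elementary_layer\<close>).
  In a decomposition of $B$ into cyclic groups there are at least $n/(e+1)$ factors, and at
  most $n/(e+1)$ of them have order $p^{e+1}$; replacing each of the latter, and if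
  necessary further ones, by its subgroup of index $p$ gives such an $H$. The proof obtains
  these two bounds from the orders of the groups of $p^i$-th powers and needs no
  decomposition.
\<close>

section \<open>Products of powers in an abelian group\<close>

lemma (in comm_group) finprod_int_pow:
  assumes "g \<in> J \<rightarrow> carrier G"
  shows "(\<Otimes>j\<in>J. g j) [^] (z::int) = (\<Otimes>j\<in>J. g j [^] z)"
  using assms
proof (induction J rule: infinite_finite_induct)
  case (insert x J)
  then have "g \<in> J \<rightarrow> carrier G" "g x \<in> carrier G" by auto
  moreover have "(\<lambda>j. g j [^] z) \<in> J \<rightarrow> carrier G" using insert by auto
  ultimately show ?case using insert by (simp add: int_pow_distrib)
qed (auto simp: int_pow_one)

lemma (in comm_group) finprod_pow_sum:
  fixes a :: "'i \<Rightarrow> 'j \<Rightarrow> int"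
  assumes "g \<in> J \<rightarrow> carrier G" "finite I"
  shows "(\<Otimes>i\<in>I. \<Otimes>j\<in>J. g j [^] a i j) = (\<Otimes>j\<in>J. g j [^] (\<Sum>i\<in>I. a i j))"
  using assms(2)
proof (induction I)
  case empty
  show ?case using assms(1) by (auto intro!: finprod_one_eqI[symmetric])
next
  case (insert x I)
  have *: "(\<lambda>j. g j [^] b j) \<in> J \<rightarrow> carrier G" for b :: "'j \<Rightarrow> int"
    using assms(1) by auto
  have "(\<Otimes>i\<in>insert x I. \<Otimes>j\<in>J. g j [^] a i j)
      = (\<Otimes>j\<in>J. g j [^] a x j) \<otimes> (\<Otimes>j\<in>J. g j [^] (\<Sum>i\<in>I. a i j))"
    using insert * by (subst finprod_insert) auto
  also have "\<dots> = (\<Otimes>j\<in>J. g j [^] a x j \<otimes> g j [^] (\<Sum>i\<in>I. a i j))"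
    using * by (simp add: finprod_multf)
  also have "\<dots> = (\<Otimes>j\<in>J. g j [^] (\<Sum>i\<in>insert x I. a i j))"
    using insert assms(1) by (intro finprod_cong') (auto simp: int_pow_mult Pi_iff)
  finally show ?case .
qed

lemma (in comm_group) finprod_lessThan_Suc:
  assumes "\<And>j. j \<le> n \<Longrightarrow> f j \<in> carrier G"
  shows "(\<Otimes>j\<in>{..<Suc n}. f j) = (\<Otimes>j\<in>{..<n}. f j) \<otimes> f n"
proof -
  have "f \<in> {..<n} \<rightarrow> carrier G" "f n \<in> carrier G" using assms by auto
  then show ?thesis unfolding lessThan_Suc by (simp add: m_comm)
qed

lemma (in comm_group) finprod_lessThan_add:
  fixes m n :: nat
  assumes "\<And>j. j < m + n \<Longrightarrow> f j \<in> carrier G"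
  shows "(\<Otimes>j\<in>{..<m+n}. f j) = (\<Otimes>j\<in>{..<m}. f j) \<otimes> (\<Otimes>j\<in>{..<n}. f (m + j))"
  using assms
proof (induction n)
  case (Suc n)
  have "(\<Otimes>j\<in>{..<m + Suc n}. f j) = (\<Otimes>j\<in>{..<m+n}. f j) \<otimes> f (m + n)"
    using Suc.prems by (simp only: add_Suc_right finprod_lessThan_Suc)
  also have "(\<Otimes>j\<in>{..<m+n}. f j) = (\<Otimes>j\<in>{..<m}. f j) \<otimes> (\<Otimes>j\<in>{..<n}. f (m + j))"
    using Suc by simp
  also have "\<dots> \<otimes> f (m + n) = (\<Otimes>j\<in>{..<m}. f j) \<otimes> ((\<Otimes>j\<in>{..<n}. f (m + j)) \<otimes> f (m + n))"
    using Suc.prems by (intro m_assoc finprod_closed) auto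
  also have "(\<Otimes>j\<in>{..<n}. f (m + j)) \<otimes> f (m + n) = (\<Otimes>j\<in>{..<Suc n}. f (m + j))"
    using Suc.prems by (subst finprod_lessThan_Suc) auto
  finally show ?case .
qed (auto intro!: r_one[symmetric] finprod_closed)

lemma (in comm_group) finprod_mem_subgroup:
  assumes "subgroup H G" "\<And>j. j \<in> J \<Longrightarrow> f j \<in> H"
  shows "(\<Otimes>j\<in>J. f j) \<in> H"
  using assms(2)
proof (induction J rule: infinite_finite_induct)
  case (insert x J)
  then have "f \<in> J \<rightarrow> carrier G" "f x \<in> carrier G"
    using subgroup.mem_carrier[OF assms(1)] by auto
  then show ?case using insert subgroup.m_closed[OF assms(1)] by simp
qed (auto simp: subgroup.one_closed[OF assms(1)])

lemma (in group) subgroup_int_pow_mem: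
  assumes "subgroup H G" "x \<in> H"
  shows "x [^] (z::int) \<in> H"
  using assms subgroup_int_pow_closed by blast

section \<open>Elementary abelian quotients\<close>

text \<open>
  The cyclic group generated by the image of $x$ modulo $H$ has prime order $p$. This is
  stated for exponents in the integers because differences of residues are used later.
\<close>

lemma (in group) int_pow_mem_subgroup_imp_dvd:
  fixes p :: nat and i :: int
  assumes "subgroup H G" "Factorial_Ring.prime p" "x \<in> carrier G" "x \<notin> H" "x [^] p \<in> H" "x [^] i \<in> H"
  shows "int p dvd i"
proof (rule ccontr)
  assume "\<not> int p dvd i"
  then have "coprime (int p) i" using assms(2) by (simp add: prime_imp_coprime)
  then obtain u v where uv: "u * int p + v * i = 1"
    using bezout_int by (metis coprime_imp_gcd_eq_1)
  have "(x [^] int p) [^] u \<otimes> (x [^] i) [^] v = x [^] (int p * u + i * v)"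
    using assms(3) by (simp add: int_pow_mult int_pow_pow)
  moreover have "(x [^] int p) [^] u \<otimes> (x [^] i) [^] v \<in> H"
    using subgroup.m_closed[OF assms(1) subgroup_int_pow_mem[OF assms(1)] subgroup_int_pow_mem[OF assms(1)]]
      assms(5,6) by (simp add: int_pow_int)
  moreover have "int p * u + i * v = 1" using uv by (simp add: mult.commute)
  ultimately show False using assms(3,4) by simp
qed

text \<open>
  The coset representatives $1, x, \dots, x^{p-1}$ of $H$ in the group generated by $H$ and
  $x$ are distinct, so adjoining $x$ multiplies the order by exactly $p$.
\<close>

lemma (in comm_group) adjoin_element:
  fixes p :: nat
  assumes H: "subgroup H G" and p: "Factorial_Ring.prime p"
    and x: "x \<in> carrier G" "x \<notin> H" "x [^] p \<in> H"
  defines "K \<equiv> {h \<otimes> x [^] (i::int) |h i. h \<in> H}"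
  shows "subgroup K G" "H \<subseteq> K" "x \<in> K" "card K = p * card H"
    "\<And>B. subgroup B G \<Longrightarrow> H \<subseteq> B \<Longrightarrow> x \<in> B \<Longrightarrow> K \<subseteq> B"
proof -
  have HG: "h \<in> carrier G" if "h \<in> H" for h using subgroup.mem_carrier[OF H that] .
  show "subgroup K G"
  proof (rule subgroupI)
    show "K \<subseteq> carrier G" using HG x(1) by (auto simp: K_def)
    show "K \<noteq> {}" using subgroup.one_closed[OF H] by (auto simp: K_def)
  next
    fix a assume "a \<in> K"
    then obtain h i where a: "a = h \<otimes> x [^] (i::int)" "h \<in> H" by (auto simp: K_def)
    have "inv a = inv h \<otimes> x [^] (- i)" using a HG x(1) by (simp add: inv_mult int_pow_neg)
    then show "inv a \<in> K" using subgroup.m_inv_closed[OF H a(2)] by (auto simp: K_def)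
  next
    fix a b assume "a \<in> K" "b \<in> K"
    then obtain h i h' i' where a: "a = h \<otimes> x [^] (i::int)" "h \<in> H"
      "b = h' \<otimes> x [^] (i'::int)" "h' \<in> H" by (auto simp: K_def)
    have "a \<otimes> b = (h \<otimes> h') \<otimes> x [^] (i + i')"
      using a HG x(1) by (simp add: int_pow_mult m_ac)
    then show "a \<otimes> b \<in> K" using subgroup.m_closed[OF H a(2,4)] by (auto simp: K_def)
  qed
  show "H \<subseteq> K"
  proof
    fix h assume h: "h \<in> H"
    then have "h = h \<otimes> x [^] (0::int)" using HG by simp
    then show "h \<in> K" using h unfolding K_def by blast
  qed
  show "x \<in> K"
  proof -
    have "x = \<one> \<otimes> x [^] (1::int)" using x(1) by simp
    then show ?thesis using subgroup.one_closed[OF H] unfolding K_def by blast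
  qed
  show sub: "\<And>B. subgroup B G \<Longrightarrow> H \<subseteq> B \<Longrightarrow> x \<in> B \<Longrightarrow> K \<subseteq> B"
    unfolding K_def by (auto intro!: subgroup.m_closed subgroup_int_pow_mem)
  let ?f = "\<lambda>(h, i). h \<otimes> x [^] (int i)"
  have "?f ` (H \<times> {..<p}) = K"
  proof (intro equalityI subsetI)
    fix a assume "a \<in> K"
    then obtain h i where a: "a = h \<otimes> x [^] (i::int)" "h \<in> H" by (auto simp: K_def)
    define q s where "q = i div int p" and "s = nat (i mod int p)"
    have p0: "int p > 0" using prime_gt_0_nat[OF p] by simp
    have i: "i = int p * q + int s" using p0 by (simp add: q_def s_def)
    have s: "s < p" unfolding s_def using p0 pos_mod_bound[OF p0, of i] pos_mod_sign[OF p0, of i]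
      by linarith
    have mem: "(x [^] p) [^] q \<in> H" using x H by (intro subgroup_int_pow_mem) auto
    have "x [^] i = (x [^] p) [^] q \<otimes> x [^] int s"
      unfolding i using x(1) by (simp add: int_pow_mult int_pow_pow flip: int_pow_int)
    then have "a = ?f (h \<otimes> (x [^] p) [^] q, s)"
      using a HG x(1) mem by (simp add: m_assoc)
    moreover have "h \<otimes> (x [^] p) [^] q \<in> H" using a(2) mem H by (simp add: subgroup.m_closed)
    ultimately show "a \<in> ?f ` (H \<times> {..<p})" using s by blast
  qed (auto simp: K_def)
  moreover have "inj_on ?f (H \<times> {..<p})"
  proof (rule inj_onI, clarify)
    fix h i h' i' assume h: "h \<in> H" "h' \<in> H" and i: "i < p" "i' < p"
      and eq: "h \<otimes> x [^] int i = h' \<otimes> x [^] int i'"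
    have "x [^] (int i - int i') = x [^] int i \<otimes> inv (x [^] int i')"
      using x(1) by (simp add: int_pow_diff)
    also have "x [^] int i = inv h \<otimes> (h' \<otimes> x [^] int i')"
      using eq h HG x(1) by (metis int_pow_closed inv_solve_left m_closed)
    also have "\<dots> \<otimes> inv (x [^] int i') = inv h \<otimes> h'"
      using h HG x(1) by (simp add: m_assoc)
    also have "\<dots> \<in> H" using h H by (simp add: subgroup.m_closed subgroup.m_inv_closed)
    finally have "int p dvd int i - int i'"
      using int_pow_mem_subgroup_imp_dvd[OF H p x] by blast
    then have "i = i'" using i
      by (metis mod_eq_dvd_iff mod_less of_nat_eq_iff zmod_int)
    then show "h = h' \<and> i = i'" using eq h HG x(1) by (metis int_pow_closed r_cancel)
  qed
  ultimately have bij: "bij_betw ?f (H \<times> {..<p}) K" by (simp add: bij_betw_def)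
  show "card K = p * card H"
    using bij_betw_same_card[OF bij] by (simp add: card_cartesian_product mult.commute)
qed

text \<open>
  An elementary abelian quotient $B/A$ has subgroups of every admissible order: adjoin
  elements of $B$ one at a time.
\<close>

lemma (in comm_group) intermediate_subgroup:
  fixes p :: nat
  assumes p: "Factorial_Ring.prime p" and A: "subgroup A G" "card A = p ^ a"
    and B: "subgroup B G" "card B = p ^ b" and AB: "A \<subseteq> B" "\<And>x. x \<in> B \<Longrightarrow> x [^] p \<in> A"
    and t: "a \<le> t" "t \<le> b"
  shows "\<exists>H. subgroup H G \<and> A \<subseteq> H \<and> H \<subseteq> B \<and> card H = p ^ t"
  using t
proof (induction t rule: dec_induct)
  case base
  then show ?case using A AB by blast
next
  case (step t)
  then obtain H where H: "subgroup H G" "A \<subseteq> H" "H \<subseteq> B" "card H = p ^ t" by auto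
  have "p ^ t < p ^ b" using step prime_gt_1_nat[OF p] by (intro power_strict_increasing) auto
  then obtain x where x: "x \<in> B" "x \<notin> H" using H B by (metis less_irrefl subset_antisym subsetI)
  have xG: "x \<in> carrier G" using x(1) B(1) by (simp add: subgroup.mem_carrier)
  have xp: "x [^] p \<in> H" using x(1) AB(2) H(2) by blast
  define K where "K = {h \<otimes> x [^] (i::int) |h i. h \<in> H}"
  note adj = adjoin_element[OF H(1) p xG x(2) xp, folded K_def]
  have "A \<subseteq> K" "K \<subseteq> B" "card K = p ^ Suc t"
    using adj(2,4) adj(5)[OF B(1) H(3) x(1)] H(2,4) by auto
  then show ?case using adj(1) by blast
qed

text \<open>
  $B/A$ is a vector space over the field with $p$ elements; the $g_j$ represent a basis.
  Independence is expressed with integer coefficients: a combination that falls into $A$ has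
  all coefficients divisible by $p$. The induction enlarges $A$ by a new element $x$, which
  becomes the last basis vector.
\<close>

lemma (in comm_group) elementary_quotient_basis:
  fixes p :: nat
  assumes p: "Factorial_Ring.prime p" and A: "subgroup A G" and B: "subgroup B G" "finite B"
    and AB: "A \<subseteq> B" "\<And>x. x \<in> B \<Longrightarrow> x [^] p \<in> A" and card: "card B = p ^ r * card A"
  shows "\<exists>g :: nat \<Rightarrow> 'a. (\<forall>j<r. g j \<in> B) \<and>
    (\<forall>c. (\<Otimes>j\<in>{..<r}. g j [^] (c j :: int)) \<in> A \<longrightarrow> (\<forall>j<r. int p dvd c j)) \<and>
    (\<forall>y\<in>B. \<exists>a\<in>A. \<exists>c. y = a \<otimes> (\<Otimes>j\<in>{..<r}. g j [^] (c j :: int)))"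
  using A AB card
proof (induction r arbitrary: A)
  case 0
  then have "A = B" using B(2) by (metis card_subset_eq mult_1 power_0)
  then show ?case using subgroup.mem_carrier[OF B(1)] by (intro exI[of _ "\<lambda>_. \<one>"]) auto
next
  case (Suc r)
  have BG: "x \<in> carrier G" if "x \<in> B" for x using subgroup.mem_carrier[OF B(1) that] .
  have finA: "finite A" using Suc.prems B(2) finite_subset by blast
  have "card A > 0" using finA subgroup.one_closed[OF Suc.prems(1)] by (auto simp: card_gt_0_iff)
  moreover have "1 < p ^ Suc r" using prime_gt_1_nat[OF p] by (rule one_less_power) simp
  ultimately have "card A \<noteq> card B" using Suc.prems(4) by (auto simp del: power_Suc)
  then obtain x where x: "x \<in> B" "x \<notin> A" using Suc.prems(2) by (metis subset_antisym subsetI)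
  have xp: "x [^] p \<in> A" using Suc.prems x by blast
  define K where "K = {h \<otimes> x [^] (i::int) |h i. h \<in> A}"
  note adj = adjoin_element[OF Suc.prems(1) p BG[OF x(1)] x(2) xp, folded K_def]
  have "card B = p ^ r * card K" using adj(4) Suc.prems(4) by simp
  moreover have "x [^] p \<in> K" if "x \<in> B" for x using adj(2) Suc.prems(3) that by blast
  ultimately have "\<exists>g :: nat \<Rightarrow> 'a. (\<forall>j<r. g j \<in> B) \<and>
    (\<forall>c. (\<Otimes>j\<in>{..<r}. g j [^] (c j :: int)) \<in> K \<longrightarrow> (\<forall>j<r. int p dvd c j)) \<and>
    (\<forall>y\<in>B. \<exists>a\<in>K. \<exists>c. y = a \<otimes> (\<Otimes>j\<in>{..<r}. g j [^] (c j :: int)))"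
    using adj(5)[OF B(1) Suc.prems(2) x(1)] by (intro Suc.IH[OF adj(1)])
  then obtain g where g: "\<And>j. j < r \<Longrightarrow> g j \<in> B"
    "\<And>c. (\<Otimes>j\<in>{..<r}. g j [^] (c j :: int)) \<in> K \<Longrightarrow> \<forall>j<r. int p dvd c j"
    "\<And>y. y \<in> B \<Longrightarrow> \<exists>a\<in>K. \<exists>c. y = a \<otimes> (\<Otimes>j\<in>{..<r}. g j [^] (c j :: int))"
    by blast
  define g' where "g' = g(r := x)"
  have gB: "(\<Otimes>j\<in>{..<r}. g j [^] (c j :: int)) \<in> carrier G" for c
    using g(1) BG by (intro finprod_closed) auto
  have split: "(\<Otimes>j\<in>{..<Suc r}. g' j [^] (c j :: int)) = (\<Otimes>j\<in>{..<r}. g j [^] c j) \<otimes> x [^] c r" for c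
  proof -
    have "(\<Otimes>j\<in>{..<Suc r}. g' j [^] (c j :: int)) = (\<Otimes>j\<in>{..<r}. g' j [^] c j) \<otimes> g' r [^] c r"
      using g(1) BG x(1) by (intro finprod_lessThan_Suc) (auto simp: g'_def less_Suc_eq_le le_less)
    also have "(\<Otimes>j\<in>{..<r}. g' j [^] c j) = (\<Otimes>j\<in>{..<r}. g j [^] c j)"
      using g(1) BG by (intro finprod_cong') (auto simp: g'_def)
    finally show ?thesis by (simp add: g'_def)
  qed
  show ?case
  proof (intro exI[of _ g'] conjI allI impI ballI)
    fix j assume "j < Suc r"
    then show "g' j \<in> B" using g(1) x(1) by (auto simp: g'_def less_Suc_eq)
  next
    fix c :: "nat \<Rightarrow> int" and j
    assume mem: "(\<Otimes>j\<in>{..<Suc r}. g' j [^] c j) \<in> A" and j: "j < Suc r"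
    define y where "y = (\<Otimes>j\<in>{..<r}. g j [^] c j)"
    have yG: "y \<in> carrier G" using gB by (simp add: y_def)
    have yx: "y \<otimes> x [^] c r \<in> A" using mem split by (simp add: y_def)
  \<comment> \<open>Modulo the larger subgroup $K$ only the earlier coefficients are visible, and they are multiples of $p$ by induction.\<close>
    have "y = (y \<otimes> x [^] c r) \<otimes> x [^] (- c r)"
      using yG BG[OF x(1)] by (simp add: m_assoc int_pow_neg)
    then have "y \<in> K" using yx unfolding K_def by blast
    then have dvd: "int p dvd c j" if "j < r" for j using g(2) that y_def by blast
    have "y \<in> A" unfolding y_def
    proof (rule finprod_mem_subgroup[OF Suc.prems(1)])
      fix j assume "j \<in> {..<r}"
      then have j: "j < r" by simp
      then obtain u where u: "c j = int p * u" using dvd by blast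
      have "(g j [^] p) [^] u \<in> A"
        using Suc.prems(1,3) g(1) j by (intro subgroup_int_pow_mem) auto
      then show "g j [^] c j \<in> A"
        using u BG[OF g(1)[OF j]] by (simp add: int_pow_pow flip: int_pow_int)
    qed
    then have "inv y \<otimes> (y \<otimes> x [^] c r) \<in> A"
      using yx Suc.prems(1) by (simp add: subgroup.m_closed subgroup.m_inv_closed)
    then have "x [^] c r \<in> A" using yG BG[OF x(1)] by (simp flip: m_assoc)
    then have "int p dvd c r"
      using int_pow_mem_subgroup_imp_dvd[OF Suc.prems(1) p BG[OF x(1)] x(2) xp] by blast
    then show "int p dvd c j" using dvd j by (auto simp: less_Suc_eq)
  next
    fix y assume "y \<in> B"
    then obtain a c where a: "a \<in> K" "y = a \<otimes> (\<Otimes>j\<in>{..<r}. g j [^] (c j :: int))" using g(3) by blast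
    then obtain h i where h: "h \<in> A" "a = h \<otimes> x [^] (i::int)" by (auto simp: K_def)
    have "(\<Otimes>j\<in>{..<r}. g j [^] ((c(r:=i)) j)) = (\<Otimes>j\<in>{..<r}. g j [^] c j)"
      using g(1) BG by (intro finprod_cong') auto
    then have "(\<Otimes>j\<in>{..<Suc r}. g' j [^] ((c(r:=i)) j)) = (\<Otimes>j\<in>{..<r}. g j [^] c j) \<otimes> x [^] i"
      using split[of "c(r:=i)"] by simp
    then have "y = h \<otimes> (\<Otimes>j\<in>{..<Suc r}. g' j [^] ((c(r:=i)) j))"
      using a(2) h gB[of c] BG[OF x(1)] subgroup.mem_carrier[OF Suc.prems(1)] by (simp add: m_ac)
    then show "\<exists>a\<in>A. \<exists>c. y = a \<otimes> (\<Otimes>j\<in>{..<Suc r}. g' j [^] (c j :: int))" using h(1) by blast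
  qed
qed

section \<open>Power maps on abelian groups of prime power order\<close>

text \<open>
  The fibres of $x \mapsto x^m$ on $B$ are cosets of the kernel.
\<close>

lemma (in comm_group) card_eq_card_kernel_times_image:
  fixes m :: nat
  assumes B: "subgroup B G" "finite B"
  shows "card B = card {x \<in> B. x [^] m = \<one>} * card ((\<lambda>x. x [^] m) ` B)"
proof -
  let ?f = "\<lambda>x. x [^] m" and ?K = "{x \<in> B. x [^] m = \<one>}"
  have BG: "x \<in> carrier G" if "x \<in> B" for x using subgroup.mem_carrier[OF B(1) that] .
  have fibre: "card {x \<in> B. ?f x = y} = card ?K" if "y \<in> ?f ` B" for y
  proof -
    obtain b where b: "b \<in> B" "y = ?f b" using \<open>y \<in> ?f ` B\<close> by auto
    have "bij_betw (\<lambda>x. b \<otimes> x) ?K {x \<in> B. ?f x = y}"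
    proof (rule bij_betw_byWitness[where f' = "\<lambda>x. inv b \<otimes> x"])
      show "(\<lambda>x. b \<otimes> x) ` ?K \<subseteq> {x \<in> B. ?f x = y}"
        using b BG B(1) by (auto simp: pow_mult_distrib m_comm subgroup.m_closed)
      show "(\<lambda>x. inv b \<otimes> x) ` {x \<in> B. ?f x = y} \<subseteq> ?K"
        using b BG B(1)
        by (auto simp: pow_mult_distrib m_comm subgroup.m_closed subgroup.m_inv_closed nat_pow_inv)
      have "inv b \<otimes> (b \<otimes> x) = x" "b \<otimes> (inv b \<otimes> x) = x" if "x \<in> B" for x
        using BG[OF b(1)] BG[OF that] by (simp_all flip: m_assoc)
      then show "\<forall>x\<in>?K. inv b \<otimes> (b \<otimes> x) = x"
        "\<forall>x\<in>{x \<in> B. ?f x = y}. b \<otimes> (inv b \<otimes> x) = x" by auto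
    qed
    then show ?thesis by (rule bij_betw_same_card[symmetric])
  qed
  have "card B = (\<Sum>y\<in>?f ` B. card {x \<in> B. ?f x = y})"
    using sum.image_gen[OF B(2), of "\<lambda>_. 1::nat" ?f] by simp
  also have "\<dots> = (\<Sum>y\<in>?f ` B. card ?K)" using fibre by (rule sum.cong[OF refl])
  finally show ?thesis by simp
qed

lemma (in comm_group) subgroup_power_kernel:
  fixes m :: nat
  assumes B: "subgroup B G"
  shows "subgroup {x \<in> B. x [^] m = \<one>} G"
proof -
  have BG: "x \<in> carrier G" if "x \<in> B" for x using subgroup.mem_carrier[OF B that] .
  show ?thesis
    using B BG by (intro subgroupI)
      (auto simp: pow_mult_distrib m_comm subgroup.m_closed subgroup.m_inv_closed nat_pow_inv
        intro: subgroup.one_closed exI[of _ \<one>])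
qed

lemma (in comm_group) subgroup_power_image:
  fixes m :: nat
  assumes B: "subgroup B G"
  shows "subgroup ((\<lambda>x. x [^] m) ` B) G"
proof (rule subgroupI)
  have BG: "x \<in> carrier G" if "x \<in> B" for x using subgroup.mem_carrier[OF B that] .
  show "(\<lambda>x. x [^] m) ` B \<subseteq> carrier G" using BG by auto
  show "(\<lambda>x. x [^] m) ` B \<noteq> {}" using subgroup.one_closed[OF B] by auto
  show "inv a \<in> (\<lambda>x. x [^] m) ` B" if "a \<in> (\<lambda>x. x [^] m) ` B" for a
    using that BG subgroup.m_inv_closed[OF B] by (auto simp: nat_pow_inv[symmetric])
  show "a \<otimes> b \<in> (\<lambda>x. x [^] m) ` B"
    if "a \<in> (\<lambda>x. x [^] m) ` B" "b \<in> (\<lambda>x. x [^] m) ` B" for a b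
    using that BG subgroup.m_closed[OF B] by (auto simp: pow_mult_distrib[symmetric] m_comm)
qed

text \<open>
  Put $B_i = \{x^{p^i} : x \in B\}$ and let $t_i$ be the number of $x \in B_i$ with $x^p = 1$.
  Then $|B_i| = t_i |B_{i+1}|$, hence $|B| = t_0 t_1 \cdots t_e$. The $t_i$ decrease because
  the $B_i$ do, so the product lies between $t_e^{e+1}$ and $t_0^{e+1}$; moreover $t_e =
  |B_e|$ because every element of $B_e$ is killed by $p$. In terms of a decomposition of $B$
  into cyclic groups, the two bounds say that $B$ has at least $n/(e+1)$ factors and that at
  most $n/(e+1)$ of them have the maximal order $p^{e+1}$, where $|B| = p^n$.
\<close>

lemma (in comm_group) card_bounds_by_torsion:
  fixes p e :: nat
  assumes B: "subgroup B G" "finite B" and exp: "\<And>x. x \<in> B \<Longrightarrow> x [^] (p ^ Suc e) = \<one>"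
  shows "card B \<le> card {x \<in> B. x [^] p = \<one>} ^ Suc e"
    and "card ((\<lambda>x. x [^] (p ^ e)) ` B) ^ Suc e \<le> card B"
proof -
  have BG: "x \<in> carrier G" if "x \<in> B" for x using subgroup.mem_carrier[OF B(1) that] .
  define I where "I i = (\<lambda>x. x [^] (p ^ i)) ` B" for i :: nat
  define K where "K i = {x \<in> I i. x [^] p = \<one>}" for i :: nat
  have I: "subgroup (I i) G" "finite (I i)" for i
    unfolding I_def using B subgroup_power_image by auto
  have I_Suc: "I (Suc i) = (\<lambda>x. x [^] p) ` I i" for i
    using BG by (simp add: I_def image_image nat_pow_pow mult.commute)
  have step: "card (I i) = card (K i) * card (I (Suc i))" for i
    unfolding I_Suc K_def by (rule card_eq_card_kernel_times_image[OF I])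
  have I_sub: "I j \<subseteq> I i" if "i \<le> j" for i j
  proof
    fix y assume "y \<in> I j"
    then obtain x where x: "x \<in> B" "y = x [^] (p ^ j)" by (auto simp: I_def)
    have "y = (x [^] (p ^ (j - i))) [^] (p ^ i)"
      using x BG that by (simp add: nat_pow_pow flip: power_add)
    moreover have "x [^] (p ^ (j - i)) \<in> B"
      using subgroup_int_pow_mem[OF B(1) x(1), of "int (p ^ (j - i))"] by (simp only: int_pow_int)
    ultimately show "y \<in> I i" by (auto simp: I_def)
  qed
  have I_end: "I (Suc e) = {\<one>}"
    using exp subgroup.one_closed[OF B(1)] by (auto simp: I_def)
  then have K_end: "K e = I e"
  proof -
    have "y [^] p = \<one>" if "y \<in> I e" for y using that I_end I_Suc[of e] by blast
    then show ?thesis by (auto simp: K_def)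
  qed
  have I0: "I 0 = B" using BG by (force simp: I_def)
  have "card B = (\<Prod>i<n. card (K i)) * card (I n)" for n
  proof (induction n)
    case (Suc n)
    then show ?case using step[of n] by (simp add: mult.assoc)
  qed (simp add: I0)
  from this[of "Suc e"] have prod: "card B = (\<Prod>i<Suc e. card (K i))" using I_end by simp
  have "(\<Prod>i<Suc e. card (K i)) \<le> (\<Prod>i<Suc e. card (K 0))"
  proof (rule prod_mono)
    fix i
    show "0 \<le> card (K i) \<and> card (K i) \<le> card (K 0)"
      using I I_sub[of 0 i] by (auto simp: K_def intro!: card_mono)
  qed
  then show "card B \<le> card {x \<in> B. x [^] p = \<one>} ^ Suc e"
    using prod I0 by (simp add: K_def)
  have "(\<Prod>i<Suc e. card (K e)) \<le> (\<Prod>i<Suc e. card (K i))"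
  proof (rule prod_mono)
    fix i assume "i \<in> {..<Suc e}"
    then show "0 \<le> card (K e) \<and> card (K e) \<le> card (K i)"
      using I I_sub[of i e] by (auto simp: K_def intro!: card_mono)
  qed
  then show "card ((\<lambda>x. x [^] (p ^ e)) ` B) ^ Suc e \<le> card B"
    using prod K_end by (simp add: I_def)
qed

lemma (in comm_group) card_subgroup_of_p_group:
  fixes p :: nat
  assumes p: "Factorial_Ring.prime p" and B: "subgroup B G" "card B = p ^ n"
    and H: "subgroup H G" "H \<subseteq> B"
  obtains m where "card H = p ^ m"
proof -
  interpret GB: group "G\<lparr>carrier := B\<rparr>" by (rule subgroup.subgroup_is_group[OF B(1) is_group])
  have "subgroup H (G\<lparr>carrier := B\<rparr>)" using subgroup_incl[OF H(1) B(1) H(2)] .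
  then have "p ^ n = card H * card (rcosets\<^bsub>G\<lparr>carrier := B\<rparr>\<^esub> H)"
    using GB.lagrange[of H] B(2) by (simp add: order_def mult.commute)
  then have "card H dvd p ^ n" by (rule dvdI)
  then show ?thesis using that divides_primepow_nat[OF p] by metis
qed

text \<open>
  The subgroup $H$ must contain all $p$-th powers (so that $B/H$ is elementary abelian), must
  lie in the kernel of $x \mapsto x^{p^e}$ (so that its exponent has dropped), must be large
  enough for the induction to continue and small enough for $B/H$ to have rank at least $k$.
  The subgroup $P$ of $p$-th powers is contained in the kernel $K$ of $x \mapsto x^{p^e}$ and
  $K/P$ is elementary abelian, so every order between $|P|$ and $|K|$ occurs; the bounds on
  the torsion say that $|P| \le p^{n-k}$ and $|K| \ge p^{ke}$, and $p^t = \max(|P|, p^{ke})$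
  serves.
\<close>

lemma (in comm_group) exists_elementary_layer:
  fixes p :: nat
  assumes p: "Factorial_Ring.prime p" and B: "subgroup B G" "card B = p ^ n"
    and exp: "\<And>x. x \<in> B \<Longrightarrow> x [^] (p ^ Suc e) = \<one>" and k: "k * Suc e \<le> n"
  obtains H t where "subgroup H G" "H \<subseteq> B" "\<And>x. x \<in> B \<Longrightarrow> x [^] p \<in> H"
    "\<And>x. x \<in> H \<Longrightarrow> x [^] (p ^ e) = \<one>" "card H = p ^ t" "k * e \<le> t" "t + k \<le> n"
proof -
  have BG: "x \<in> carrier G" if "x \<in> B" for x using subgroup.mem_carrier[OF B(1) that] .
  have p1: "p > 1" using prime_gt_1_nat[OF p] .
  have fin: "finite B" using B(2) p1 by (intro card_ge_0_finite) simp
  have pow_sub: "(\<lambda>x. x [^] m) ` B \<subseteq> B" for m :: nat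
    using subgroup_int_pow_mem[OF B(1), of _ "int m"] by (auto simp: int_pow_int)
  let ?T = "{x \<in> B. x [^] p = \<one>}" and ?P = "(\<lambda>x. x [^] p) ` B"
    and ?K = "{x \<in> B. x [^] (p ^ e) = \<one>}" and ?S = "(\<lambda>x. x [^] (p ^ e)) ` B"
  have sub: "subgroup ?P G" "subgroup ?K G"
    using subgroup_power_image[OF B(1)] subgroup_power_kernel[OF B(1)] by auto
  obtain m where m: "card ?T = p ^ m"
    by (rule card_subgroup_of_p_group[OF p B subgroup_power_kernel[OF B(1), of p]]) auto
  obtain s where s: "card ?S = p ^ s"
    by (rule card_subgroup_of_p_group[OF p B subgroup_power_image[OF B(1), of "p ^ e"] pow_sub])
  obtain a where a: "card ?P = p ^ a"
    by (rule card_subgroup_of_p_group[OF p B sub(1) pow_sub])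
  obtain b where b: "card ?K = p ^ b"
    by (rule card_subgroup_of_p_group[OF p B sub(2)]) auto
  have "p ^ n = p ^ (m + a)"
    using card_eq_card_kernel_times_image[OF B(1) fin, of p] B(2) m a by (simp add: power_add)
  then have n1: "n = m + a" using p1 power_inject_exp by blast
  have "p ^ n = p ^ (b + s)"
    using card_eq_card_kernel_times_image[OF B(1) fin, of "p ^ e"] B(2) b s by (simp add: power_add)
  then have n2: "n = b + s" using p1 power_inject_exp by blast
  \<comment> \<open>By the upper torsion bound $|B/P| = p^m$ is large, so $H = P$ would leave enough room above.\<close>
  have "p ^ n \<le> p ^ (m * Suc e)"
    using card_bounds_by_torsion(1)[OF B(1) fin exp] by (simp only: B(2) m power_mult)
  then have "n \<le> m * Suc e" using p1 power_le_imp_le_exp by blast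
  then have km: "k \<le> m" using k by (metis Suc_mult_le_cancel1 le_trans mult.commute)
  \<comment> \<open>By the lower torsion bound $|B/K| = p^s$ is small, so $K$ is large enough for the induction.\<close>
  have "p ^ (s * Suc e) \<le> p ^ n"
    using card_bounds_by_torsion(2)[OF B(1) fin exp] by (simp only: B(2) s power_mult)
  then have "s * Suc e \<le> n" using p1 power_le_imp_le_exp by blast
  then have "n * e \<le> b * Suc e" using n2 by (simp add: algebra_simps)
  moreover have "k * Suc e * e \<le> n * e" using k by (rule mult_le_mono1)
  ultimately have "Suc e * (k * e) \<le> Suc e * b" by (simp add: algebra_simps)
  then have kb: "k * e \<le> b" by (simp only: Suc_mult_le_cancel1)
  have PK: "?P \<subseteq> ?K"
  proof -
    have "(x [^] p) [^] (p ^ e) = \<one>" if "x \<in> B" for x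
      using exp[OF that] BG[OF that] by (simp add: nat_pow_pow)
    then show ?thesis using pow_sub by blast
  qed
  then have "card ?P \<le> card ?K" using fin by (intro card_mono) auto
  then have "p ^ a \<le> p ^ b" by (simp only: a b)
  then have ab: "a \<le> b" using p1 power_le_imp_le_exp by blast
  obtain H where H: "subgroup H G" "?P \<subseteq> H" "H \<subseteq> ?K" "card H = p ^ max a (k * e)"
    using intermediate_subgroup[OF p sub(1) a sub(2) b PK, of "max a (k * e)"] ab kb by auto
  show ?thesis
  proof (rule that[OF H(1) _ _ _ H(4)])
    show "max a (k * e) + k \<le> n" using n1 km k by auto
  qed (use H in auto)
qed

section \<open>Fields with a prime power number of elements\<close>

text \<open>
  By Pascal's rule, as for numbers; it is stated for rings with an explicit carrier because the
  characteristic is a variable and no type of fields of characteristic $p$ can depend on it.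
\<close>

lemma (in cring) binomial_expansion:
  assumes x: "x \<in> carrier R" and y: "y \<in> carrier R"
  shows "(x \<oplus> y) [^] n = (\<Oplus>k\<in>{..n}. [(n choose k)] \<cdot> (x [^] k \<otimes> y [^] (n - k)))"
proof (induction n)
  case 0
  then show ?case using x y by simp
next
  case (Suc n)
  define f where "f k = [(n choose k)] \<cdot> (x [^] Suc k \<otimes> y [^] (n - k))" for k
  define g where "g k = [(n choose k)] \<cdot> (x [^] k \<otimes> y [^] (Suc n - k))" for k
  define t where "t k = [(Suc n choose k)] \<cdot> (x [^] k \<otimes> y [^] (Suc n - k))" for k
  have cl: "f k \<in> carrier R" "g k \<in> carrier R" "t k \<in> carrier R" for k
    using x y by (simp_all add: f_def g_def t_def)
  let ?s = "\<Oplus>k\<in>{..n}. [(n choose k)] \<cdot> (x [^] k \<otimes> y [^] (n - k))"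
  have s: "?s \<in> carrier R" using x y by (intro finsum_closed) auto
  have "(x \<oplus> y) [^] Suc n = ?s \<otimes> x \<oplus> ?s \<otimes> y"
    using s x y by (simp add: Suc.IH r_distr)
  also have "?s \<otimes> x = (\<Oplus>k\<in>{..n}. f k)"
  proof -
    have "?s \<otimes> x = (\<Oplus>k\<in>{..n}. [(n choose k)] \<cdot> (x [^] k \<otimes> y [^] (n - k)) \<otimes> x)"
      using x y by (intro finsum_ldistr) auto
    also have "\<dots> = (\<Oplus>k\<in>{..n}. f k)"
      using x y cl by (intro finsum_cong') (auto simp: f_def add_pow_ldistr add_pow_rdistr m_ac)
    finally show ?thesis .
  qed
  also have "?s \<otimes> y = (\<Oplus>k\<in>{..n}. g k)"
  proof -
    have "?s \<otimes> y = (\<Oplus>k\<in>{..n}. [(n choose k)] \<cdot> (x [^] k \<otimes> y [^] (n - k)) \<otimes> y)"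
      using x y by (intro finsum_ldistr) auto
    also have "\<dots> = (\<Oplus>k\<in>{..n}. g k)"
      using x y cl by (intro finsum_cong') (auto simp: g_def add_pow_ldistr m_assoc Suc_diff_le)
    finally show ?thesis .
  qed
  also have "(\<Oplus>k\<in>{..n}. g k) = (\<Oplus>k\<in>{..Suc n}. g k)"
    using x y cl by (subst finsum_Suc) (auto simp: g_def binomial_eq_0)
  also have "\<dots> = (\<Oplus>k\<in>{..n}. g (Suc k)) \<oplus> g 0" using cl by (subst finsum_Suc2) auto
  also have "(\<Oplus>k\<in>{..n}. f k) \<oplus> ((\<Oplus>k\<in>{..n}. g (Suc k)) \<oplus> g 0)
      = (\<Oplus>k\<in>{..n}. f k \<oplus> g (Suc k)) \<oplus> g 0"
    using cl by (subst finsum_addf) (auto simp: a_assoc)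
  also have "(\<Oplus>k\<in>{..n}. f k \<oplus> g (Suc k)) = (\<Oplus>k\<in>{..n}. t (Suc k))"
    using x y cl by (intro finsum_cong') (auto simp: f_def g_def t_def add.nat_pow_mult)
  also have "g 0 = t 0" by (simp add: g_def t_def)
  also have "(\<Oplus>k\<in>{..n}. t (Suc k)) \<oplus> t 0 = (\<Oplus>k\<in>{..Suc n}. t k)"
    using cl by (subst finsum_Suc2) auto
  finally show ?case by (simp add: t_def)
qed

lemma (in cring) add_pow_dvd_char:
  fixes p n :: nat
  assumes "[p] \<cdot> \<one> = \<zero>" "p dvd n" "x \<in> carrier R"
  shows "[n] \<cdot> x = \<zero>"
proof -
  obtain m where m: "n = p * m" using assms(2) by blast
  have "[p] \<cdot> x = ([p] \<cdot> \<one>) \<otimes> x" using assms(3) by (simp add: add_pow_ldistr)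
  then have "[p] \<cdot> x = \<zero>" using assms(1,3) by simp
  then have "[m] \<cdot> ([p] \<cdot> x) = \<zero>" by (simp add: add.nat_pow_one)
  then show ?thesis using assms(3) m by (simp add: add.nat_pow_pow)
qed

lemma (in cring) frobenius_add:
  fixes p :: nat
  assumes p: "Factorial_Ring.prime p" and char: "[p] \<cdot> \<one> = \<zero>"
    and x: "x \<in> carrier R" and y: "y \<in> carrier R"
  shows "(x \<oplus> y) [^] p = x [^] p \<oplus> y [^] p"
proof -
  obtain m where m: "p = Suc m" using prime_gt_0_nat[OF p] gr0_implies_Suc by blast
  let ?t = "\<lambda>k. [(p choose k)] \<cdot> (x [^] k \<otimes> y [^] (p - k))"
  have cl: "?t k \<in> carrier R" for k using x y by simp
  have "(x \<oplus> y) [^] p = (\<Oplus>k\<in>{..Suc m}. ?t k)"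
    using binomial_expansion[OF x y, of p] m by simp
  also have "\<dots> = ?t p \<oplus> (\<Oplus>k\<in>{..m}. ?t k)"
    using cl m by (subst finsum_Suc) auto
  also have "(\<Oplus>k\<in>{..m}. ?t k) = (\<Oplus>k\<in>{..m}. if k = 0 then ?t k else \<zero>)"
  proof (rule finsum_cong')
    fix k assume "k \<in> {..m}"
    then have "p dvd (p choose k)" if "k \<noteq> 0"
      using that m p by (intro dvd_choose_prime) auto
    then show "?t k = (if k = 0 then ?t k else \<zero>)"
      using add_pow_dvd_char[OF char] x y by simp
  qed (use x y in auto)
  also have "\<dots> = ?t 0" using cl by (intro add.finprod_singleton_swap) auto
  finally show ?thesis using x y by simp
qed

text \<open>
  The $p^r$-th power map is additive in characteristic $p$, so its fixed points form a
  subring.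
\<close>

lemma (in cring) frobenius_power_add:
  fixes p :: nat
  assumes p: "Factorial_Ring.prime p" and char: "[p] \<cdot> \<one> = \<zero>"
    and x: "x \<in> carrier R" and y: "y \<in> carrier R"
  shows "(x \<oplus> y) [^] (p ^ r) = x [^] (p ^ r) \<oplus> y [^] (p ^ r)"
proof (induction r)
  case (Suc r)
  have *: "z [^] (p ^ Suc r) = (z [^] (p ^ r)) [^] p" if "z \<in> carrier R" for z
    using that by (simp add: nat_pow_pow mult.commute)
  show ?case using x y Suc by (simp add: * frobenius_add[OF p char] del: power_Suc)
qed (use x y in auto)

text \<open>
  The factor $s$ is $\sum_i x^i y^{n-1-i}$. With $h$ the evaluation of polynomials at a root,
  $h(s)$ is the value of the derivative of $X^n - y^n$, obtained here without differentiation.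
\<close>

lemma ring_hom_cring_power_diff:
  fixes R (structure) and S (structure) and n :: nat
  assumes "ring_hom_cring R S h" and x: "x \<in> carrier R" and y: "y \<in> carrier R" and h: "h x = h y"
  shows "\<exists>s\<in>carrier R. x [^]\<^bsub>R\<^esub> n \<ominus>\<^bsub>R\<^esub> y [^]\<^bsub>R\<^esub> n = (x \<ominus>\<^bsub>R\<^esub> y) \<otimes>\<^bsub>R\<^esub> s \<and>
    h s = [n] \<cdot>\<^bsub>S\<^esub> (h y [^]\<^bsub>S\<^esub> (n - 1))"
proof -
  interpret ring_hom_cring R S h by fact
  show ?thesis
  proof (induction n)
    case 0
    show ?case using x y by (intro bexI[of _ "\<zero>\<^bsub>R\<^esub>"]) (auto simp: R.minus_eq R.r_neg)
  next
    case (Suc n)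
    then obtain s where s: "s \<in> carrier R"
      "x [^]\<^bsub>R\<^esub> n \<ominus>\<^bsub>R\<^esub> y [^]\<^bsub>R\<^esub> n = (x \<ominus>\<^bsub>R\<^esub> y) \<otimes>\<^bsub>R\<^esub> s" "h s = [n] \<cdot>\<^bsub>S\<^esub> (h y [^]\<^bsub>S\<^esub> (n - 1))" by auto
    let ?s = "x [^]\<^bsub>R\<^esub> n \<oplus>\<^bsub>R\<^esub> y \<otimes>\<^bsub>R\<^esub> s"
    have pw: "x [^]\<^bsub>R\<^esub> n \<in> carrier R" "y [^]\<^bsub>R\<^esub> n \<in> carrier R" using x y by auto
    have "x [^]\<^bsub>R\<^esub> Suc n \<ominus>\<^bsub>R\<^esub> y [^]\<^bsub>R\<^esub> Suc n
        = (x \<ominus>\<^bsub>R\<^esub> y) \<otimes>\<^bsub>R\<^esub> x [^]\<^bsub>R\<^esub> n \<oplus>\<^bsub>R\<^esub> y \<otimes>\<^bsub>R\<^esub> (x [^]\<^bsub>R\<^esub> n \<ominus>\<^bsub>R\<^esub> y [^]\<^bsub>R\<^esub> n)"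
      using x y pw unfolding R.nat_pow_Suc by algebra
    also have "\<dots> = (x \<ominus>\<^bsub>R\<^esub> y) \<otimes>\<^bsub>R\<^esub> ?s"
      unfolding s(2) using x y pw s(1) by algebra
    finally have "x [^]\<^bsub>R\<^esub> Suc n \<ominus>\<^bsub>R\<^esub> y [^]\<^bsub>R\<^esub> Suc n = (x \<ominus>\<^bsub>R\<^esub> y) \<otimes>\<^bsub>R\<^esub> ?s" .
    moreover have "h ?s = [Suc n] \<cdot>\<^bsub>S\<^esub> (h y [^]\<^bsub>S\<^esub> n)"
    proof -
      have "h ?s = h y [^]\<^bsub>S\<^esub> n \<oplus>\<^bsub>S\<^esub> h y \<otimes>\<^bsub>S\<^esub> ([n] \<cdot>\<^bsub>S\<^esub> (h y [^]\<^bsub>S\<^esub> (n - 1)))"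
        using x y s h by simp
      also have "h y \<otimes>\<^bsub>S\<^esub> ([n] \<cdot>\<^bsub>S\<^esub> (h y [^]\<^bsub>S\<^esub> (n - 1))) = [n] \<cdot>\<^bsub>S\<^esub> (h y [^]\<^bsub>S\<^esub> n)"
      proof -
        have "h y \<otimes>\<^bsub>S\<^esub> ([n] \<cdot>\<^bsub>S\<^esub> (h y [^]\<^bsub>S\<^esub> (n - 1))) = [n] \<cdot>\<^bsub>S\<^esub> (h y \<otimes>\<^bsub>S\<^esub> h y [^]\<^bsub>S\<^esub> (n - 1))"
          using y by (simp add: S.add_pow_rdistr)
        also have "\<dots> = [n] \<cdot>\<^bsub>S\<^esub> (h y [^]\<^bsub>S\<^esub> n)"
          using y by (cases n) (auto simp: S.m_comm)
        finally show ?thesis .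
      qed
      finally show ?thesis using y by (simp add: S.a_comm)
    qed
    ultimately show ?case using x y s(1) by (intro bexI[of _ ?s]) auto
  qed
qed

text \<open>
  The polynomial $X^n - 1$ splits, and a root $a$ is simple because the cofactor of $X - a$
  takes the nonzero value $n a^{n-1}$ at $a$.
\<close>

lemma (in algebraically_closed) card_roots_of_unity:
  assumes n: "[n] \<cdot> \<one> \<noteq> \<zero>"
  shows "card {x \<in> carrier L. x [^] n = \<one>} = n"
proof -
  let ?P = "poly_ring L"
  interpret P: domain ?P using univ_poly_is_domain[OF carrier_is_subring] .
  have n0: "n > 0" using n by (cases n) auto
  define f where "f = X [^]\<^bsub>?P\<^esub> n \<ominus>\<^bsub>?P\<^esub> \<one>\<^bsub>?P\<^esub>"
  have X: "X \<in> carrier ?P" by (rule var_closed(1)[OF carrier_is_subring])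
  have f: "f \<in> carrier ?P" using X by (simp add: f_def)
  have ev: "ring_hom_cring ?P L (\<lambda>g. eval g a)" if "a \<in> carrier L" for a
    by (rule eval_cring_hom[OF carrier_is_subring that])
  have eval_f: "eval f a = a [^] n \<ominus> \<one>" if a: "a \<in> carrier L" for a
  proof -
    interpret E: ring_hom_cring ?P L "\<lambda>g. eval g a" by (rule ev[OF a])
    have "eval f a = eval (X [^]\<^bsub>?P\<^esub> n) a \<ominus> eval \<one>\<^bsub>?P\<^esub> a"
      unfolding f_def using X by (simp add: a_minus_def del: E.hom_one)
    then show ?thesis using X a by (simp add: eval_var)
  qed
  have "\<ominus>\<^bsub>?P\<^esub> [\<one>] = [\<ominus> \<one>]"
    using univ_poly_a_inv_def'[OF carrier_is_subring P.one_closed] by (simp add: univ_poly_one)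
  then have f_list: "f = poly_add (monom \<one> n) [\<ominus> \<one>]"
    unfolding f_def a_minus_def unitary_monom_eq_var_pow[OF carrier_is_subring]
    by (simp only: univ_poly_add univ_poly_one)
  have pol: "polynomial (carrier L) (monom \<one> n)" "polynomial (carrier L) [\<ominus> \<one>]"
    by (auto simp: polynomial_def monom_def)
  have deg: "degree f = n"
    unfolding f_list using poly_add_degree_eq[OF carrier_is_subring pol] n0
    by (simp add: monom_def)
  have f0: "f \<noteq> []" using deg n0 by auto
  have root: "a \<in># roots f \<longleftrightarrow> a \<in> carrier L \<and> a [^] n = \<one>" for a
    using roots_mem_iff_is_root[OF f, of a] eval_f[of a] f0 r_right_minus_eq[of "a [^] n" \<one>]
    by (auto simp: is_root_def simp del: r_right_minus_eq)
  have simple: "count (roots f) a = 1" if a: "a \<in># roots f" for a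
  proof -
    have aL: "a \<in> carrier L" and an: "a [^] n = \<one>" using a root by auto
    have a0: "a \<noteq> \<zero>" using an n0 by (auto simp: nat_pow_zero)
    have pow_nz: "a [^] m \<noteq> \<zero>" for m :: nat
      using a0 aL integral_iff by (induction m) auto
    have C: "[a] \<in> carrier ?P"
      using aL a0 by (simp add: polynomial_def flip: univ_poly_carrier)
    have "[a] [^]\<^bsub>?P\<^esub> m = [a [^] m]" for m :: nat
    proof (induction m)
      case (Suc m)
      then show ?case using aL a0 pow_nz[of m] integral_iff
        by (simp add: univ_poly_mult)
    qed (simp add: univ_poly_one)
    then have Cn: "[a] [^]\<^bsub>?P\<^esub> n = \<one>\<^bsub>?P\<^esub>" using an by (simp add: univ_poly_one)
    have XC: "X \<ominus>\<^bsub>?P\<^esub> [a] = [\<one>, \<ominus> a]"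
      using aL C by (simp add: a_minus_def univ_poly_a_inv_def'[OF carrier_is_subring]
          univ_poly_add var_def)
  \<comment> \<open>Since $a^n = 1$, the polynomial is $X^n - a^n$, and evaluation at $a$ sends $X$ and the constant $a$ to the same element.\<close>
    obtain h where h: "h \<in> carrier ?P" "f = [\<one>, \<ominus> a] \<otimes>\<^bsub>?P\<^esub> h" "eval h a = [n] \<cdot> (a [^] (n - 1))"
      using ring_hom_cring_power_diff[OF ev[OF aL] X C, of n] aL Cn XC
      by (auto simp: f_def eval_var)
    have "eval h a = ([n] \<cdot> \<one>) \<otimes> a [^] (n - 1)"
      using h(3) aL by (simp add: add_pow_ldistr)
    then have "eval h a \<noteq> \<zero>" using n aL a0 pow_nz[of "n - 1"] integral_iff by auto
    then have "a \<notin># roots h" using roots_mem_iff_is_root[OF h(1)] by (simp add: is_root_def)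
    moreover have "h \<noteq> []" using \<open>eval h a \<noteq> \<zero>\<close> by auto
    then have "roots f = add_mset a (roots h)"
      using poly_mult_degree_one_monic_imp_same_roots[OF aL h(1)] h(2) by simp
    ultimately show ?thesis by (simp add: not_in_iff)
  qed
  have "n = size (roots f)" using roots_over_carrier[OF f] deg by (simp add: splitted_def)
  also have "\<dots> = card (set_mset (roots f))"
    using simple by (simp add: size_multiset_overloaded_eq)
  also have "set_mset (roots f) = {x \<in> carrier L. x [^] n = \<one>}" using root by auto
  finally show ?thesis by simp
qed

text \<open>
  The fixed points of the $q$-th power map, $q = p^r$, are $0$ and the $(q-1)$-th roots of
  unity; there are $q - 1$ of the latter because $q - 1$ is $-1$ in characteristic $p$.
\<close>

lemma (in algebraically_closed) exists_finite_subdomain: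
  fixes p r :: nat
  assumes p: "Factorial_Ring.prime p" and char: "[p] \<cdot> \<one> = \<zero>" and r: "r \<ge> 1"
  shows "\<exists>F. subring F L \<and> card F = p ^ r"
proof -
  define q where "q = p ^ r"
  have q1: "q > 1" unfolding q_def using prime_gt_1_nat[OF p] r by (intro one_less_power) auto
  obtain m where m: "q = Suc m" "m > 0" using q1 by (cases q) auto
  have frob: "(x \<oplus> y) [^] q = x [^] q \<oplus> y [^] q" if "x \<in> carrier L" "y \<in> carrier L" for x y
    unfolding q_def by (rule frobenius_power_add[OF p char that])
  define F where "F = {x \<in> carrier L. x [^] q = x}"
  have "subring F L"
  proof (rule subringI)
  \<comment> \<open>Additivity of the $q$-th power map at $x$ and $-x$; this avoids a case distinction on the parity of $q$.\<close>
    fix x assume x: "x \<in> F"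
    then have xL: "x \<in> carrier L" "x [^] q = x" by (auto simp: F_def)
    have "(x \<oplus> \<ominus> x) [^] q = \<zero>" using xL q1 by (simp add: r_neg nat_pow_zero)
    then have "x \<oplus> (\<ominus> x) [^] q = \<zero>" using xL frob[of x "\<ominus> x"] by simp
    then have "\<ominus> x = (\<ominus> x) [^] q" using xL by (metis a_inv_closed minus_equality nat_pow_closed a_comm)
    then show "\<ominus> x \<in> F" using xL by (simp add: F_def)
  qed (auto simp: F_def frob nat_pow_distrib)
  moreover have "card F = q"
  proof -
    have "[q] \<cdot> \<one> = \<zero>" using add_pow_dvd_char[OF char, of q] r by (simp add: q_def)
    then have "[m] \<cdot> \<one> \<oplus> \<one> = \<zero>" using m by simp
    then have "[m] \<cdot> \<one> \<noteq> \<zero>" by auto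
    then have card: "card {x \<in> carrier L. x [^] m = \<one>} = m" by (rule card_roots_of_unity)
    have "x [^] q = x \<longleftrightarrow> x = \<zero> \<or> x [^] m = \<one>" if x: "x \<in> carrier L" for x
    proof -
      have "x [^] q = x [^] m \<otimes> x" using m by simp
      then show ?thesis using x m_rcancel[of x "x [^] m" \<one>] by auto
    qed
    then have "F = insert \<zero> {x \<in> carrier L. x [^] m = \<one>}" by (auto simp: F_def)
    moreover have "\<zero> \<notin> {x \<in> carrier L. x [^] m = \<one>}" using m(2) by (simp add: nat_pow_zero)
    moreover have "finite {x \<in> carrier L. x [^] m = \<one>}" using card m(2) by (intro card_ge_0_finite) simp
    ultimately show ?thesis using card m by simp
  qed
  ultimately show ?thesis by (auto simp: q_def)
qed

section \<open>Bilinear forms without zero divisors\<close>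

text \<open>
  The integers $T_{ijl}$ are the structure constants of a bilinear map $\mathbb{F}_p^r \times
  \mathbb{F}_p^r \to \mathbb{F}_p^r$ without zero divisors. Working with integers modulo $p$
  lets the constants serve as exponents in an arbitrary group.
\<close>

definition nonsingular_form_mod :: "nat \<Rightarrow> nat \<Rightarrow> (nat \<Rightarrow> nat \<Rightarrow> nat \<Rightarrow> int) \<Rightarrow> bool" where
  "nonsingular_form_mod p r T \<longleftrightarrow> (\<forall>d c.
     (\<forall>l<r. int p dvd (\<Sum>i<r. \<Sum>j<r. d i * c j * T i j l)) \<longrightarrow>
     (\<forall>i<r. int p dvd d i) \<or> (\<forall>j<r. int p dvd c j))"

text \<open>
  Expand products of basis elements of the domain $R$ over the field with $p$ elements: $b_i
  b_j = \sum_l T_{ijl} b_l$. A zero of the resulting form at $(d, c)$ is a zero product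
  $(\sum_i d_i b_i)(\sum_j c_j b_j)$, so one of the factors vanishes and its coefficients are
  divisible by $p$.
\<close>

lemma (in domain) structure_constants_nonsingular:
  fixes p r :: nat
  assumes p: "Factorial_Ring.prime p" and char: "[p] \<cdot> \<one> = \<zero>"
    and card: "card (carrier R) = p ^ r"
  shows "\<exists>T. nonsingular_form_mod p r T"
proof -
  have fin: "finite (carrier R)"
    using card prime_gt_0_nat[OF p] by (intro card_ge_0_finite) simp
  have px: "[p] \<cdot> x = \<zero>" if "x \<in> carrier R" for x using add_pow_dvd_char[OF char _ that, of p] by simp
  have sub: "subgroup {\<zero>} (add_monoid R)" "subgroup (carrier R) (add_monoid R)"
    using add.triv_subgroup add.subgroup_self by auto
  obtain b :: "nat \<Rightarrow> 'a" where b: "\<And>j. j < r \<Longrightarrow> b j \<in> carrier R"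
    "\<And>c. (\<Oplus>j\<in>{..<r}. [(c j)] \<cdot> b j) = \<zero> \<Longrightarrow> \<forall>j<r. int p dvd c j"
    "\<And>y. y \<in> carrier R \<Longrightarrow> \<exists>c. y = (\<Oplus>j\<in>{..<r}. [(c j :: int)] \<cdot> b j)"
  proof -
    have "\<exists>b :: nat \<Rightarrow> 'a. (\<forall>j<r. b j \<in> carrier R) \<and>
      (\<forall>c. (\<Oplus>j\<in>{..<r}. [(c j :: int)] \<cdot> b j) \<in> {\<zero>} \<longrightarrow> (\<forall>j<r. int p dvd c j)) \<and>
      (\<forall>y\<in>carrier R. \<exists>a\<in>{\<zero>}. \<exists>c. y = a \<oplus> (\<Oplus>j\<in>{..<r}. [(c j :: int)] \<cdot> b j))"
      using px card by (intro add.elementary_quotient_basis[OF p sub fin]) auto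
    then obtain b :: "nat \<Rightarrow> 'a" where b: "\<forall>j<r. b j \<in> carrier R"
      "\<forall>c. (\<Oplus>j\<in>{..<r}. [(c j :: int)] \<cdot> b j) \<in> {\<zero>} \<longrightarrow> (\<forall>j<r. int p dvd c j)"
      "\<forall>y\<in>carrier R. \<exists>a\<in>{\<zero>}. \<exists>c. y = a \<oplus> (\<Oplus>j\<in>{..<r}. [(c j :: int)] \<cdot> b j)" by blast
    have "(\<Oplus>j\<in>{..<r}. [(c j :: int)] \<cdot> b j) \<in> carrier R" for c
      using b(1) by (intro finsum_closed) auto
    then show ?thesis using b by (intro that[of b]) auto
  qed
  have bR: "b \<in> {..<r} \<rightarrow> carrier R" using b(1) by auto
  have comb: "(\<Oplus>j\<in>{..<r}. [(c j :: int)] \<cdot> b j) \<in> carrier R" for c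
    using b(1) by (intro finsum_closed) auto
  define T where "T i j = (SOME c. b i \<otimes> b j = (\<Oplus>l\<in>{..<r}. [(c l :: int)] \<cdot> b l))" for i j
  have T: "b i \<otimes> b j = (\<Oplus>l\<in>{..<r}. [(T i j l)] \<cdot> b l)" if "i < r" "j < r" for i j
  proof -
    have "b i \<otimes> b j \<in> carrier R" using b(1) that by simp
    from someI_ex[OF b(3)[OF this]] show ?thesis by (simp only: T_def)
  qed
  show ?thesis
  proof (intro exI[of _ T], unfold nonsingular_form_mod_def, intro allI impI)
    fix d c :: "nat \<Rightarrow> int"
    assume dvd: "\<forall>l<r. int p dvd (\<Sum>i<r. \<Sum>j<r. d i * c j * T i j l)"
    define x where "x = (\<Oplus>i\<in>{..<r}. [(d i)] \<cdot> b i)"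
    define y where "y = (\<Oplus>j\<in>{..<r}. [(c j)] \<cdot> b j)"
    have xy: "x \<in> carrier R" "y \<in> carrier R" using comb by (simp_all add: x_def y_def)
    have b_times_y: "b i \<otimes> y = (\<Oplus>l\<in>{..<r}. [(\<Sum>j<r. T i j l * c j)] \<cdot> b l)" if i: "i < r" for i
    proof -
      have "b i \<otimes> y = (\<Oplus>j\<in>{..<r}. b i \<otimes> ([(c j)] \<cdot> b j))"
        unfolding y_def using b(1) i by (intro finsum_rdistr) auto
      also have "\<dots> = (\<Oplus>j\<in>{..<r}. \<Oplus>l\<in>{..<r}. [(T i j l * c j)] \<cdot> b l)"
      proof (rule finsum_cong')
        fix j assume "j \<in> {..<r}"
        then have j: "j < r" by simp
        have "b i \<otimes> ([(c j)] \<cdot> b j) = [(c j)] \<cdot> (b i \<otimes> b j)"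
          using b(1) i j by (simp add: add_pow_rdistr_int)
        also have "\<dots> = (\<Oplus>l\<in>{..<r}. [(T i j l * c j)] \<cdot> b l)"
          unfolding T[OF i j] using bR
          by (subst add.finprod_int_pow) (auto simp: add.int_pow_pow Pi_iff intro!: finsum_cong')
        finally show "b i \<otimes> ([(c j)] \<cdot> b j) = (\<Oplus>l\<in>{..<r}. [(T i j l * c j)] \<cdot> b l)" .
      qed (use comb in auto)
      also have "\<dots> = (\<Oplus>l\<in>{..<r}. [(\<Sum>j<r. T i j l * c j)] \<cdot> b l)"
        using bR by (intro add.finprod_pow_sum) auto
      finally show ?thesis .
    qed
    have "x \<otimes> y = (\<Oplus>i\<in>{..<r}. ([(d i)] \<cdot> b i) \<otimes> y)"
      unfolding x_def using b(1) xy by (intro finsum_ldistr) auto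
    also have "\<dots> = (\<Oplus>i\<in>{..<r}. \<Oplus>l\<in>{..<r}. [((\<Sum>j<r. T i j l * c j) * d i)] \<cdot> b l)"
    proof (rule finsum_cong')
      fix i assume "i \<in> {..<r}"
      then have i: "i < r" by simp
      have "([(d i)] \<cdot> b i) \<otimes> y = [(d i)] \<cdot> (b i \<otimes> y)"
        using b(1) i xy by (simp add: add_pow_ldistr_int)
      also have "\<dots> = (\<Oplus>l\<in>{..<r}. [((\<Sum>j<r. T i j l * c j) * d i)] \<cdot> b l)"
        unfolding b_times_y[OF i] using bR
        by (subst add.finprod_int_pow) (auto simp: add.int_pow_pow Pi_iff intro!: finsum_cong')
      finally show "([(d i)] \<cdot> b i) \<otimes> y = (\<Oplus>l\<in>{..<r}. [((\<Sum>j<r. T i j l * c j) * d i)] \<cdot> b l)" .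
    qed (use comb in auto)
    also have "\<dots> = (\<Oplus>l\<in>{..<r}. [(\<Sum>i<r. (\<Sum>j<r. T i j l * c j) * d i)] \<cdot> b l)"
      using bR by (intro add.finprod_pow_sum) auto
    also have "\<dots> = \<zero>"
    proof (rule add.finprod_one_eqI)
      fix l assume "l \<in> {..<r}"
      then have l: "l < r" by simp
      have "(\<Sum>i<r. (\<Sum>j<r. T i j l * c j) * d i) = (\<Sum>i<r. \<Sum>j<r. d i * c j * T i j l)"
        by (simp add: sum_distrib_left sum_distrib_right mult_ac)
      then have "int p dvd (\<Sum>i<r. (\<Sum>j<r. T i j l * c j) * d i)" using dvd l by simp
      then obtain u where u: "(\<Sum>i<r. (\<Sum>j<r. T i j l * c j) * d i) = int p * u" ..
      have "[(int p * u)] \<cdot> b l = [u] \<cdot> ([int p] \<cdot> b l)"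
        using b(1)[OF l] by (simp add: add.int_pow_pow)
      then show "[(\<Sum>i<r. (\<Sum>j<r. T i j l * c j) * d i)] \<cdot> b l = \<zero>"
        using px[OF b(1)[OF l]] u by (simp add: add_pow_int_ge)
    qed
    finally have "x = \<zero> \<or> y = \<zero>" using xy integral by blast
    then show "(\<forall>i<r. int p dvd d i) \<or> (\<forall>j<r. int p dvd c j)"
      using b(2) by (auto simp: x_def y_def)
  qed
qed

lemma exists_nonsingular_form:
  fixes p r :: nat
  assumes p: "Factorial_Ring.prime p" and r: "r \<ge> 1"
  shows "\<exists>T. nonsingular_form_mod p r T"
proof -
  define R where "R = residue_ring (int p)"
  interpret R: residues_prime p R by unfold_locales (use p R_def in auto)
  let ?L = "R.alg_closure"
  interpret L: algebraic_closure ?L "R.indexed_const ` carrier R" by (rule R.alg_closureE(1))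
  interpret h: ring_hom_ring R ?L R.indexed_const
    using R.alg_closureE(2) by (intro ring_hom_ringI2 R.ring_axioms L.ring_axioms)
  have "[k] \<cdot>\<^bsub>?L\<^esub> \<one>\<^bsub>?L\<^esub> = R.indexed_const ([k] \<cdot>\<^bsub>R\<^esub> \<one>\<^bsub>R\<^esub>)" for k :: nat
    by (induction k) simp_all
  moreover have "[k] \<cdot>\<^bsub>R\<^esub> \<one>\<^bsub>R\<^esub> = int k mod int p" for k :: nat
    by (induction k) (simp_all add: R.zero_cong R.one_cong R.add_cong R.res_add_eq R.res_zero_eq R.res_one_eq mod_simps add.commute)
  ultimately have char: "[p] \<cdot>\<^bsub>?L\<^esub> \<one>\<^bsub>?L\<^esub> = \<zero>\<^bsub>?L\<^esub>"
    using h.hom_zero R.res_zero_eq by simp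
  obtain F where F: "subring F ?L" "card F = p ^ r"
    using L.exists_finite_subdomain[OF p char r] by blast
  interpret F: domain "?L\<lparr>carrier := F\<rparr>" by (rule L.subring_is_domain[OF F(1)])
  have "[k] \<cdot>\<^bsub>?L\<lparr>carrier := F\<rparr>\<^esub> \<one>\<^bsub>?L\<^esub> = [k] \<cdot>\<^bsub>?L\<^esub> \<one>\<^bsub>?L\<^esub>" for k :: nat
    by (simp add: add_pow_def nat_pow_def)
  then show ?thesis using F.structure_constants_nonsingular[OF p _ , of r] char F(2) by simp
qed

section \<open>Independent columns along a filtration\<close>

text \<open>
  If $g_0, \dots, g_{r-1}$ is a basis of $B/A$ and $N_{ij} = \prod_l g_l^{T_{ijl}}$, then
  $\prod_{i,j} N_{ij}^{d_i c_j}$ has as its coordinates the values of the bilinear form at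
  $(d, c)$. When $k < r$ only the first $k$ rows are kept, that is, $d$ is extended by zero.
\<close>

lemma (in comm_group) elementary_layer_matrix:
  fixes p :: nat
  assumes p: "Factorial_Ring.prime p" and T: "nonsingular_form_mod p r T"
    and A: "subgroup A G" and B: "subgroup B G" "finite B"
    and AB: "A \<subseteq> B" "\<And>x. x \<in> B \<Longrightarrow> x [^] p \<in> A" and card: "card B = p ^ r * card A"
    and kr: "k \<le> r"
  obtains N where "\<And>i j. i < k \<Longrightarrow> j < r \<Longrightarrow> N i j \<in> B"
    "\<And>d c. \<exists>i<k. \<not> int p dvd d i \<Longrightarrow> (\<Otimes>j\<in>{..<r}. \<Otimes>i\<in>{..<k}. N i j [^] (d i * c j)) \<in> A \<Longrightarrow>
       \<forall>j<r. int p dvd c j"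
proof -
  obtain g where g: "\<And>j. j < r \<Longrightarrow> g j \<in> B"
    "\<And>c. (\<Otimes>j\<in>{..<r}. g j [^] (c j :: int)) \<in> A \<Longrightarrow> \<forall>j<r. int p dvd c j"
    using elementary_quotient_basis[OF p A B AB card] by blast
  have gG: "g \<in> {..<r} \<rightarrow> carrier G" using g(1) subgroup.mem_carrier[OF B(1)] by auto
  define N where "N i j = (\<Otimes>l\<in>{..<r}. g l [^] T i j l)" for i j
  have N: "N i j [^] z = (\<Otimes>l\<in>{..<r}. g l [^] (T i j l * z))" for i j and z :: int
    unfolding N_def using gG by (subst finprod_int_pow) (auto simp: int_pow_pow Pi_iff intro!: finprod_cong')
  show ?thesis
  proof (rule that)
    show "N i j \<in> B" for i j
      unfolding N_def using g(1) B(1) by (intro finprod_mem_subgroup subgroup_int_pow_mem) auto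
  next
    fix d c :: "nat \<Rightarrow> int"
    assume d: "\<exists>i<k. \<not> int p dvd d i"
      and mem: "(\<Otimes>j\<in>{..<r}. \<Otimes>i\<in>{..<k}. N i j [^] (d i * c j)) \<in> A"
    define d' where "d' i = (if i < k then d i else 0)" for i
    have "(\<Otimes>j\<in>{..<r}. \<Otimes>i\<in>{..<k}. N i j [^] (d i * c j))
        = (\<Otimes>l\<in>{..<r}. g l [^] (\<Sum>j<r. \<Sum>i<k. T i j l * (d i * c j)))"
      unfolding N using gG by (simp add: finprod_pow_sum)
    with mem have "(\<Otimes>l\<in>{..<r}. g l [^] (\<Sum>j<r. \<Sum>i<k. T i j l * (d i * c j))) \<in> A" by simp
    then have "\<forall>l<r. int p dvd (\<Sum>j<r. \<Sum>i<k. T i j l * (d i * c j))" by (rule g(2))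
    moreover have "(\<Sum>j<r. \<Sum>i<k. T i j l * (d i * c j)) = (\<Sum>i<r. \<Sum>j<r. d' i * c j * T i j l)" for l
    proof -
      have "(\<Sum>i<k. T i j l * (d i * c j)) = (\<Sum>i<r. d' i * c j * T i j l)" for j
        using kr by (intro sum.mono_neutral_cong_left) (auto simp: d'_def)
      then show ?thesis by (simp add: sum.swap[of "\<lambda>i j. d' i * c j * T i j l"])
    qed
    ultimately have "(\<forall>i<r. int p dvd d' i) \<or> (\<forall>j<r. int p dvd c j)"
      using T unfolding nonsingular_form_mod_def by simp
    moreover obtain i where "i < k" "\<not> int p dvd d i" using d by blast
    then have "i < r" "\<not> int p dvd d' i" using kr by (auto simp: d'_def)
    ultimately show "\<forall>j<r. int p dvd c j" by blast
  qed
qed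

text \<open>
  Induction on the exponent of $B$: a matrix for $H$ is preceded by the $r$ columns of a
  matrix for the layer $B/H$. In a relation between all the columns the columns of $H$
  disappear modulo $H$, so the first $r$ coefficients are divisible by $p$ and hence vanish,
  being smaller than $p$ in absolute value; what remains is a relation in $H$.
\<close>

lemma (in comm_group) exists_independent_matrix:
  fixes p :: nat
  assumes p: "Factorial_Ring.prime p" and T: "\<And>r. r \<ge> 1 \<Longrightarrow> nonsingular_form_mod p r (T r)"
    and B: "subgroup B G" "card B = p ^ n"
    and exp: "\<And>x. x \<in> B \<Longrightarrow> x [^] (p ^ e) = \<one>" and k: "k * e \<le> n"
  shows "\<exists>M. (\<forall>i<k. \<forall>j<n. M i j \<in> B) \<and>
    (\<forall>d c. (\<exists>i<k. \<not> int p dvd d i) \<longrightarrow> (\<forall>j<n. \<bar>c j\<bar> < int p) \<longrightarrow>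
       (\<Otimes>j\<in>{..<n}. \<Otimes>i\<in>{..<k}. M i j [^] (d i * c j)) = \<one> \<longrightarrow> (\<forall>j<n. c j = 0))"
  using B exp k
proof (induction e arbitrary: B n)
  case 0
  have "B = {\<one>}"
  proof -
    have "x = \<one>" if "x \<in> B" for x using 0(3)[OF that] subgroup.mem_carrier[OF 0(1) that] by simp
    then show ?thesis using subgroup.one_closed[OF 0(1)] by blast
  qed
  then have "p ^ n = p ^ 0" using 0(2) by simp
  then have "n = 0" using prime_gt_1_nat[OF p] power_inject_exp by blast
  then show ?case by simp
next
  case (Suc e)
  show ?case
  proof (cases "k = 0")
    case False
    have BG: "x \<in> carrier G" if "x \<in> B" for x using subgroup.mem_carrier[OF Suc.prems(1) that] .
    obtain H t where H: "subgroup H G" "H \<subseteq> B" "\<And>x. x \<in> B \<Longrightarrow> x [^] p \<in> H"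
      "\<And>x. x \<in> H \<Longrightarrow> x [^] (p ^ e) = \<one>" "card H = p ^ t" "k * e \<le> t" "t + k \<le> n"
      using exists_elementary_layer[OF p Suc.prems] by blast
    obtain r where r: "n = r + t" using H(7) by (metis add.commute add_leE le_Suc_ex)
    have kr: "k \<le> r" using H(7) r by simp
    have fin: "finite B" using Suc.prems(2) prime_gt_0_nat[OF p] by (intro card_ge_0_finite) simp
    obtain M where M: "\<forall>i<k. \<forall>j<t. M i j \<in> H"
      "\<And>d c. \<lbrakk>\<exists>i<k. \<not> int p dvd d i; \<forall>j<t. \<bar>c j\<bar> < int p;
         (\<Otimes>j\<in>{..<t}. \<Otimes>i\<in>{..<k}. M i j [^] (d i * c j)) = \<one>\<rbrakk> \<Longrightarrow> \<forall>j<t. c j = 0"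
      using Suc.IH[OF H(1,5,4,6)] by blast
    have "card B = p ^ r * card H" using Suc.prems(2) H(5) r by (simp add: power_add)
    moreover have "nonsingular_form_mod p r (T r)" using T kr False by simp
    ultimately obtain N where N: "\<And>i j. i < k \<Longrightarrow> j < r \<Longrightarrow> N i j \<in> B"
      "\<And>d c. \<exists>i<k. \<not> int p dvd d i \<Longrightarrow> (\<Otimes>j\<in>{..<r}. \<Otimes>i\<in>{..<k}. N i j [^] (d i * c j)) \<in> H \<Longrightarrow>
         \<forall>j<r. int p dvd c j"
      using elementary_layer_matrix[OF p _ H(1) Suc.prems(1) fin H(2,3) _ kr] by blast
    define L where "L i j = (if j < r then N i j else M i (j - r))" for i j
    have LB: "L i j \<in> B" if "i < k" "j < n" for i j
      using that N(1) M(1) H(2) r by (auto simp: L_def)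
    show ?thesis
    proof (intro exI[of _ L] conjI allI impI)
      show "L i j \<in> B" if "i < k" "j < n" for i j using LB that .
    next
      fix d c :: "nat \<Rightarrow> int" and j
      assume d: "\<exists>i<k. \<not> int p dvd d i" and c: "\<forall>j<n. \<bar>c j\<bar> < int p"
        and one: "(\<Otimes>j\<in>{..<n}. \<Otimes>i\<in>{..<k}. L i j [^] (d i * c j)) = \<one>" and j: "j < n"
      let ?N = "\<Otimes>j\<in>{..<r}. \<Otimes>i\<in>{..<k}. N i j [^] (d i * c j)"
      let ?M = "\<Otimes>j\<in>{..<t}. \<Otimes>i\<in>{..<k}. M i j [^] (d i * c (r + j))"
      have NG: "N i j [^] z \<in> carrier G" if "i < k" "j < r" for i j and z :: int
        using N(1) BG that by auto
      have MH: "M i j [^] z \<in> H" if "i < k" "j < t" for i j and z :: int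
        using M(1) that H(1) by (intro subgroup_int_pow_mem) auto
      have MG: "M i j [^] z \<in> carrier G" if "i < k" "j < t" for i j and z :: int
        using MH[OF that] H(1) by (simp add: subgroup.mem_carrier)
      have M_in: "?M \<in> H" using MH H(1) by (intro finprod_mem_subgroup) auto
      have N_in: "?N \<in> carrier G" using NG by (intro finprod_closed) auto
      have "(\<Otimes>j\<in>{..<n}. \<Otimes>i\<in>{..<k}. L i j [^] (d i * c j))
          = (\<Otimes>j\<in>{..<r}. \<Otimes>i\<in>{..<k}. L i j [^] (d i * c j))
            \<otimes> (\<Otimes>j\<in>{..<t}. \<Otimes>i\<in>{..<k}. L i (r + j) [^] (d i * c (r + j)))"
        unfolding r using LB BG r by (intro finprod_lessThan_add finprod_closed) auto
      also have "(\<Otimes>j\<in>{..<r}. \<Otimes>i\<in>{..<k}. L i j [^] (d i * c j)) = ?N"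
        using NG by (intro finprod_cong') (auto simp: L_def)
      also have "(\<Otimes>j\<in>{..<t}. \<Otimes>i\<in>{..<k}. L i (r + j) [^] (d i * c (r + j))) = ?M"
        using MG by (intro finprod_cong') (auto simp: L_def)
      finally have NM: "?N \<otimes> ?M = \<one>" using one by simp
      have "inv ?M = ?N"
        by (rule inv_equality[OF NM subgroup.mem_carrier[OF H(1) M_in] N_in])
      then have "?N \<in> H" using subgroup.m_inv_closed[OF H(1) M_in] by simp
      then have "int p dvd c j" if "j < r" for j using N(2)[OF d] that by blast
      then have c0: "c j = 0" if "j < r" for j
        using c that r zdvd_not_zless by (metis dvd_imp_le_int linorder_not_less trans_less_add1 abs_of_nat)
      have "?N = \<one>" using c0 by (intro finprod_one_eqI) auto
      then have "?M = \<one>" using NM M_in H(1) by (simp add: subgroup.mem_carrier)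
      moreover have "\<forall>j<t. \<bar>c (r + j)\<bar> < int p" using c r by simp
      ultimately have "\<forall>j<t. c (r + j) = 0" by (intro M(2)[OF d, of "\<lambda>j. c (r + j)"])
      then show "c j = 0" using c0 j r by (metis le_add_diff_inverse linorder_not_less nat_add_left_cancel_less)
    qed
  qed auto
qed

section \<open>From independent columns to difference matrices\<close>

lemma finite_residue_tuples [simp]: "finite (residue_tuples p k)"
  unfolding residue_tuples_def by (intro finite_PiE) auto

lemma card_residue_tuples: "card (residue_tuples p k) = p ^ k"
  unfolding residue_tuples_def by (simp add: card_PiE)

lemma residue_tuples_eqI:
  assumes "r \<in> residue_tuples p k" "s \<in> residue_tuples p k" "\<And>i. i < k \<Longrightarrow> r i = s i"
  shows "r = s"
  using assms unfolding residue_tuples_def by (intro PiE_ext) auto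

lemma residue_tuples_less: "r \<in> residue_tuples p k \<Longrightarrow> i < k \<Longrightarrow> r i < p"
  unfolding residue_tuples_def by auto

lemma (in comm_group) finprod_Times:
  assumes "finite I" "finite J" "\<And>i j. i \<in> I \<Longrightarrow> j \<in> J \<Longrightarrow> f i j \<in> carrier G"
  shows "finprod G (\<lambda>(i, j). f i j) (I \<times> J) = (\<Otimes>j\<in>J. \<Otimes>i\<in>I. f i j)"
proof -
  have "finprod G (\<lambda>(i, j). f i j) (I \<times> J) = finprod G (\<lambda>(i, j). f i j) (\<Union>j\<in>J. I \<times> {j})"
    by (rule arg_cong[of _ _ "finprod G _"]) auto
  also have "\<dots> = (\<Otimes>j\<in>J. finprod G (\<lambda>(i, j). f i j) (I \<times> {j}))"
    using assms by (intro finprod_UN_disjoint) (auto simp: pairwise_def)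
  also have "\<dots> = (\<Otimes>j\<in>J. \<Otimes>i\<in>I. f i j)"
  proof (rule finprod_cong')
    fix j assume j: "j \<in> J"
    have "finprod G (\<lambda>(i, j). f i j) ((\<lambda>i. (i, j)) ` I) = (\<Otimes>i\<in>I. f i j)"
      using assms j by (subst finprod_reindex) (auto simp: inj_on_def)
    moreover have "(\<lambda>i. (i, j)) ` I = I \<times> {j}" by auto
    ultimately show "finprod G (\<lambda>(i, j). f i j) (I \<times> {j}) = (\<Otimes>i\<in>I. f i j)" by simp
  qed (use assms in \<open>auto intro!: finprod_closed\<close>)
  finally show ?thesis .
qed

lemma (in comm_group) expansion_eq:
  assumes "\<And>i j. i < k \<Longrightarrow> j < l \<Longrightarrow> M i j \<in> carrier G"
  shows "expansion G k l M r c = (\<Otimes>j\<in>{..<l}. \<Otimes>i\<in>{..<k}. M i j [^] (int (r i) * int (c j)))"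
proof -
  have "expansion G k l M r c = (\<Otimes>j\<in>{..<l}. \<Otimes>i\<in>{..<k}. M i j [^] (r i * c j))"
    unfolding expansion_def using assms by (intro finprod_Times) auto
  also have "\<dots> = (\<Otimes>j\<in>{..<l}. \<Otimes>i\<in>{..<k}. M i j [^] (int (r i) * int (c j)))"
    using assms by (intro finprod_cong' funcsetI finprod_closed) (auto simp flip: int_pow_int)
  finally show ?thesis .
qed

lemma (in comm_group) finprod_divide:
  assumes "f \<in> I \<rightarrow> carrier G" "g \<in> I \<rightarrow> carrier G"
  shows "(\<Otimes>i\<in>I. f i) \<otimes> inv (\<Otimes>i\<in>I. g i) = (\<Otimes>i\<in>I. f i \<otimes> inv (g i))"
proof -
  have "inv (\<Otimes>i\<in>I. g i) = (\<Otimes>i\<in>I. inv (g i))"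
    using finprod_int_pow[OF assms(2), of "-1"] assms(2)
    by (simp add: int_pow_neg finprod_closed Pi_iff cong: finprod_cong)
  moreover have "(\<lambda>i. inv (g i)) \<in> I \<rightarrow> carrier G" using assms(2) by auto
  ultimately show ?thesis using assms(1) by (simp add: finprod_multf)
qed

lemma (in comm_group) finprod_finprod_divide:
  fixes a b :: "'i \<Rightarrow> 'j \<Rightarrow> int"
  assumes "\<And>i j. i \<in> I \<Longrightarrow> j \<in> J \<Longrightarrow> M i j \<in> carrier G"
  shows "(\<Otimes>j\<in>J. \<Otimes>i\<in>I. M i j [^] a i j) \<otimes> inv (\<Otimes>j\<in>J. \<Otimes>i\<in>I. M i j [^] b i j)
    = (\<Otimes>j\<in>J. \<Otimes>i\<in>I. M i j [^] (a i j - b i j))"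
proof -
  have cl: "(\<Otimes>i\<in>I. M i j [^] z i j) \<in> carrier G" if "j \<in> J" for j and z :: "'i \<Rightarrow> 'j \<Rightarrow> int"
    using assms that by (intro finprod_closed) auto
  have "(\<Otimes>j\<in>J. \<Otimes>i\<in>I. M i j [^] a i j) \<otimes> inv (\<Otimes>j\<in>J. \<Otimes>i\<in>I. M i j [^] b i j)
     = (\<Otimes>j\<in>J. (\<Otimes>i\<in>I. M i j [^] a i j) \<otimes> inv (\<Otimes>i\<in>I. M i j [^] b i j))"
    using cl by (intro finprod_divide) auto
  also have "\<dots> = (\<Otimes>j\<in>J. \<Otimes>i\<in>I. M i j [^] (a i j - b i j))"
  proof (rule finprod_cong')
    fix j assume j: "j \<in> J"
    have "(\<Otimes>i\<in>I. M i j [^] a i j) \<otimes> inv (\<Otimes>i\<in>I. M i j [^] b i j)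
        = (\<Otimes>i\<in>I. M i j [^] a i j \<otimes> inv (M i j [^] b i j))"
      using assms j by (intro finprod_divide) auto
    also have "\<dots> = (\<Otimes>i\<in>I. M i j [^] (a i j - b i j))"
      using assms j by (intro finprod_cong') (auto simp: int_pow_diff)
    finally show "(\<Otimes>i\<in>I. M i j [^] a i j) \<otimes> inv (\<Otimes>i\<in>I. M i j [^] b i j)
        = (\<Otimes>i\<in>I. M i j [^] (a i j - b i j))" .
  qed (use cl in auto)
  finally show ?thesis .
qed

text \<open>
  Two distinct rows $r, s$ of the expansion differ by the row belonging to $d = r - s$, which
  is not divisible by $p$. Two columns $c, c'$ at which this row takes the same value differ
  by a vector with entries smaller than $p$ in absolute value, so independence forces $c =
  c'$. There are as many columns as group elements, hence every element is taken exactly once.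
\<close>

lemma (in comm_group) contracted_difference_matrixI:
  fixes p :: nat
  assumes p: "Factorial_Ring.prime p" and order: "order G = p ^ n" and n: "1 \<le> n"
    and M: "\<And>i j. i < k \<Longrightarrow> j < n \<Longrightarrow> M i j \<in> carrier G"
      "\<And>d c. \<lbrakk>\<exists>i<k. \<not> int p dvd d i; \<forall>j<n. \<bar>c j\<bar> < int p;
         (\<Otimes>j\<in>{..<n}. \<Otimes>i\<in>{..<k}. M i j [^] (d i * c j)) = \<one>\<rbrakk> \<Longrightarrow> \<forall>j<n. c j = 0"
  shows "contracted_difference_matrix G p n k 0 M"
proof -
  have "p ^ n > 1" using prime_gt_1_nat[OF p] n by (intro one_less_power) auto
  then have order1: "order G > 1" using order by simp
  have card: "card (carrier G) = p ^ n" using order by (simp add: order_def)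
  have fin: "finite (carrier G)" using order1 by (intro card_ge_0_finite) (simp add: order_def)
  define A where "A = expansion G k n M"
  have A: "A r c = (\<Otimes>j\<in>{..<n}. \<Otimes>i\<in>{..<k}. M i j [^] (int (r i) * int (c j)))" for r c
    unfolding A_def using M(1) by (rule expansion_eq)
  have cl: "(\<Otimes>j\<in>{..<n}. \<Otimes>i\<in>{..<k}. M i j [^] z i j) \<in> carrier G" for z :: "nat \<Rightarrow> nat \<Rightarrow> int"
    using M(1) by (intro finprod_closed funcsetI) auto
  have diff: "card {c \<in> residue_tuples p n. A r c \<otimes> inv (A s c) = g} = 1"
    if rs: "r \<in> residue_tuples p k" "s \<in> residue_tuples p k" "r \<noteq> s" and g: "g \<in> carrier G" for r s g
  proof -
    define d where "d i = int (r i) - int (s i)" for i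
    define D where "D c = (\<Otimes>j\<in>{..<n}. \<Otimes>i\<in>{..<k}. M i j [^] (d i * int (c j)))" for c
    have AD: "A r c \<otimes> inv (A s c) = D c" for c
      unfolding A D_def using M(1)
      by (subst finprod_finprod_divide) (auto simp: d_def left_diff_distrib)
    obtain i where i: "i < k" "r i \<noteq> s i" using residue_tuples_eqI[OF rs(1,2)] rs(3) by blast
    have "\<not> int p dvd d i"
      using zdvd_not_zless[of "\<bar>d i\<bar>" "int p"] i residue_tuples_less[OF rs(1) i(1)]
        residue_tuples_less[OF rs(2) i(1)] by (auto simp: d_def)
    then have d: "\<exists>i<k. \<not> int p dvd d i" using i by blast
    have inj: "inj_on D (residue_tuples p n)"
    proof (rule inj_onI)
      fix c c' assume c: "c \<in> residue_tuples p n" "c' \<in> residue_tuples p n" "D c = D c'"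
      have "\<one> = D c \<otimes> inv (D c')" using c(3) cl by (simp add: D_def)
      also have "\<dots> = (\<Otimes>j\<in>{..<n}. \<Otimes>i\<in>{..<k}. M i j [^] (d i * (int (c j) - int (c' j))))"
        unfolding D_def using M(1)
        by (subst finprod_finprod_divide) (auto simp: right_diff_distrib)
      finally have "(\<Otimes>j\<in>{..<n}. \<Otimes>i\<in>{..<k}. M i j [^] (d i * (int (c j) - int (c' j)))) = \<one>" ..
      moreover have "\<forall>j<n. \<bar>int (c j) - int (c' j)\<bar> < int p"
        using residue_tuples_less[OF c(1)] residue_tuples_less[OF c(2)] by fastforce
      ultimately have "\<forall>j<n. int (c j) - int (c' j) = 0"
        by (intro M(2)[OF d, of "\<lambda>j. int (c j) - int (c' j)"])
      then show "c = c'" by (intro residue_tuples_eqI[OF c(1,2)]) auto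
    qed
    have "D ` residue_tuples p n \<subseteq> carrier G" using cl by (auto simp: D_def)
    moreover have "card (D ` residue_tuples p n) = card (carrier G)"
      using inj by (simp add: card_image card_residue_tuples card)
    ultimately have "D ` residue_tuples p n = carrier G" using fin by (intro card_subset_eq)
    then obtain c where c: "c \<in> residue_tuples p n" "D c = g" using g by (metis imageE)
    then have "{c \<in> residue_tuples p n. D c = g} = {c}" using inj by (auto dest: inj_onD)
    then show ?thesis by (simp add: AD)
  qed
  have "difference_matrix G (p ^ k) (p ^ 0) (residue_tuples p k) (residue_tuples p n) A"
    unfolding difference_matrix_def
    using is_group order1 diff cl by (simp add: card_residue_tuples order A)
  then show ?thesis
    unfolding contracted_difference_matrix_def using p order comm_group_axioms M(1) by (simp add: A_def)
qed

theorem corollary5p13: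
  fixes G :: "('a, 'b) monoid_scheme" and p n e :: nat
  assumes "Factorial_Ring.prime p"
    and "comm_group G"
    and "1 \<le> n" and "1 \<le> e"
    and "order G = p ^ n"
    and "has_exponent G (p ^ e)"
  shows "\<exists>M. contracted_difference_matrix G p n (n div e) 0 M"
proof -
  interpret comm_group G by fact
  note p = assms(1)
  have "\<forall>r. \<exists>T. r \<ge> 1 \<longrightarrow> nonsingular_form_mod p r T"
    using exists_nonsingular_form[OF p] by blast
  then obtain T where T: "\<And>r. r \<ge> 1 \<Longrightarrow> nonsingular_form_mod p r (T r)" by metis
  have card: "card (carrier G) = p ^ n" using assms(5) by (simp add: order_def)
  have exp: "x [^]\<^bsub>G\<^esub> (p ^ e) = \<one>\<^bsub>G\<^esub>" if "x \<in> carrier G" for x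
    using assms(6) that by (simp add: has_exponent_def)
  have "n div e * e \<le> n" by simp
  from exists_independent_matrix[OF p T subgroup_self card exp this]
  show ?thesis using contracted_difference_matrixI[OF p assms(5,3)] by blast
qed

end
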